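(* Let $\ell_1,\dots,\ell_m$ be any $m$ linear functions of $d$ variables (of the form $\ell_j(\mathbf z)=1-\sum_ib_i^{(j)}z_i$ with $\mathbf b^{(j)}\in\mathbb R^d\setminus\{0\}$, pairwise distinct). (i) The set of rational functions $$\left\{\frac1{\ell_{i_1}(\mathbf z)\cdots\ell_{i_s}(\mathbf z)}:\{\ell_{i_1},\dots,\ell_{i_s}\}\text{ is }\chi\text{-independent}\right\}$$ is linearly independent over $\mathbb C$. (ii) The span over $\mathbb C$ of the rational functions $$\left\{\frac1{\ell_{i_1}(\mathbf z)^{p_1}\cdots\ell_{i_s}(\mathbf z)^{p_s}}:\{\ell_{i_1},\dots,\ell_{i_s}\}\text{ is }\chi\text{-independent and }\sum_{i=1}^sp_i=M\right\}$$ contains the inverses of all products of the $\ell_j$ over multisets of cardinality $M$. (iii) The algorithm SimpleDecomp, applied to a rational function $F=G/\prod_{j=1}^m\ell_j^{p_j}$, terminates in a finite number of steps and outputs a sum of rational functions whose supports contain no broken circuits.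
   Context: In (ii) the exponents $p_i$ are positive integers; in (iii) $G$ is a polynomial and the $p_j\ge1$ are integers. Linear (in)dependence of a set of $\ell_j$'s means linear (in)dependence as functions. The support of a rational function $G/(\ell_1^{q_1}\cdots\ell_m^{q_m})$ in lowest terms (no $\ell_j$ with $q_j>0$ divides $G$) is $\sup=\{\ell_j:q_j>0\}$. A circuit is a minimal linearly dependent subset of $\{\ell_1,\dots,\ell_m\}$. A broken circuit is the independent set obtained from a circuit by removing the element of largest index. A subset is $\chi$-independent if it contains no broken circuit. Exchange identity: if $0=a_1\ell_{i_1}+\dots+a_s\ell_{i_s}$ with all $a_k\neq0$, then for $\mathbf q\in\mathbb N^m$ and any $j\in\{1,\dots,s\}$, writing $\boldsymbol\ell^{\mathbf q}=\prod_k\ell_k^{q_k}$ and $\mathbf e^{(\kappa)}$ for the standard basis vectors, $$\frac1{\boldsymbol\ell^{\mathbf q}}=\sum_{k\ne j}\frac{-a_k/a_j}{\boldsymbol\ell^{\mathbf q+\mathbf e^{(i_j)}-\mathbf e^{(i_k)}}}.$$ Algorithm SimpleDecomp. Input: $F=G/\prod_j\ell_j^{p_j}$. Output: rational functions whose sum is $F$. Start with the sum $S$ consisting of the single summand $F$. (1) While some summand $\tilde F$ of $S$ has support containing a broken circuit $\{\ell_{i_1},\dots,\ell_{i_s}\}$ ($i_1<\dots<i_s$), choose an index $i>i_s$ such that $\{\ell_{i_1},\dots,\ell_{i_s},\ell_i\}$ is linearly dependent and replace $\tilde F$ in $S$ by the result of applying the exchange identity to this dependence with $\ell_i$ as the distinguished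 element (its exponent is raised by one while the exponent of one of the $\ell_{i_k}$ is lowered by one in each new term). (2) Collect and simplify summands with the same denominator. (3) While some summand has numerator in the ideal generated by its support in $\mathbb C[z_1,\dots,z_d]$: among all such summands pick one whose denominator has maximal total degree, write its numerator as a polynomial combination of the elements in its denominator, expand the new fraction and simplify, removing terms in the denominator, and collect and simplify summands with the same denominator.
   Formalization: In (i) linear independence is proved for each fixed size s of the χ-independent sets separately; with s varying it is false: for ℓ_1=1-z, ℓ_2=1+z there are no circuits, but 1/ℓ_1+1/ℓ_2=2/(ℓ_1ℓ_2). *)

theory Defs
  imports
    "HOL-Analysis.Finite_Cartesian_Product"
    "HOL-Library.Poly_Mapping"
    "HOL-Library.Multiset"
    "HOL-Computational_Algebra.Fraction_Field"
begin

section \<open>Polynomials and rational functions in finitely many variables\<close>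

text \<open>
  The index type \<open>'d\<close> plays the role of \<open>{1, \<dots>, d}\<close>. Its linear order is only there because the
  library needs one to make the polynomial ring an integral domain.
\<close>

type_synonym 'd cpoly = "('d \<Rightarrow>\<^sub>0 nat) \<Rightarrow>\<^sub>0 complex"
type_synonym 'd ratfun = "'d cpoly fract"

definition Const :: "complex \<Rightarrow> 'd cpoly"
  where "Const c = Poly_Mapping.single 0 c"

definition Var :: "'d \<Rightarrow> 'd cpoly"
  where "Var i = Poly_Mapping.single (Poly_Mapping.single i 1) 1"

definition pscale :: "complex \<Rightarrow> 'd cpoly \<Rightarrow> 'd cpoly"
  where "pscale c p = Const c * p"

definition rscale :: "complex \<Rightarrow> 'd::linorder ratfun \<Rightarrow> 'd ratfun"
  where "rscale c f = Fract (Const c) 1 * f"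

lemma Const_add: "Const (c + c') = Const c + Const c'"
  by (simp add: Const_def single_add)

lemma Const_mult: "Const (c * c') = Const c * Const c'"
  by (simp add: Const_def mult_single)

lemma Const_1: "Const 1 = 1"
  by (simp add: Const_def)

interpretation cpoly: vector_space pscale
  by unfold_locales (simp_all add: pscale_def Const_add Const_mult Const_1 algebra_simps)

interpretation ratfun: vector_space rscale
proof unfold_locales
  fix c c' :: complex and f :: "'a ratfun"
  have "Fract (Const c + Const c') 1 = Fract (Const c) 1 + (Fract (Const c') 1 :: 'a ratfun)"
    by simp
  then show "rscale (c + c') f = rscale c f + rscale c' f"
    by (simp only: rscale_def Const_add distrib_right)
  have "Fract (Const c * Const c') 1 = Fract (Const c) 1 * (Fract (Const c') 1 :: 'a ratfun)"
    by simp
  then show "rscale c (rscale c' f) = rscale (c * c') f"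
    by (simp only: rscale_def Const_mult mult.assoc)
  show "rscale 1 f = f"
    by (simp add: rscale_def Const_1 flip: One_fract_def)
qed (simp add: rscale_def distrib_left)

interpretation ideal: module "(*) :: 'a::comm_ring_1 \<Rightarrow> 'a \<Rightarrow> 'a"
  by unfold_locales (simp_all add: algebra_simps)

definition linear_function :: "real ^ 'd \<Rightarrow> ('d::finite) cpoly"
  where "linear_function b = 1 - (\<Sum>i\<in>UNIV. Const (complex_of_real (b $ i)) * Var i)"


section \<open>Circuits and broken circuits\<close>

text \<open>
  Sets of linear functions are given by their sets of indices in \<open>{1..m}\<close>; the family \<open>l\<close> is
  always injective there. Linear dependence over \<open>\<complex>\<close> in the polynomial ring is dependence as
  functions, since \<open>\<complex>\<close> is infinite.
\<close>

definition circuit :: "(nat \<Rightarrow> 'd cpoly) \<Rightarrow> nat \<Rightarrow> nat set \<Rightarrow> bool"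
  where "circuit l m C \<longleftrightarrow> C \<subseteq> {1..m} \<and> cpoly.dependent (l ` C) \<and>
    (\<forall>C'. C' \<subset> C \<longrightarrow> cpoly.independent (l ` C'))"

definition broken_circuit :: "(nat \<Rightarrow> 'd cpoly) \<Rightarrow> nat \<Rightarrow> nat set \<Rightarrow> bool"
  where "broken_circuit l m B \<longleftrightarrow> (\<exists>C. circuit l m C \<and> B = C - {Max C})"

definition chi_independent :: "(nat \<Rightarrow> 'd cpoly) \<Rightarrow> nat \<Rightarrow> nat set \<Rightarrow> bool"
  where "chi_independent l m I \<longleftrightarrow> I \<subseteq> {1..m} \<and> (\<forall>B. broken_circuit l m B \<longrightarrow> \<not> B \<subseteq> I)"

text \<open>
  Linear independence of the reciprocals \<open>1 / \<Prod>\<^sub>i\<^sub>\<in>\<^sub>I l\<^sub>i\<close> over chi-independent \<open>I\<close> is meant for each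
  cardinality of \<open>I\<close> separately. Since the \<open>l\<^sub>i\<close> are not homogeneous it fails across cardinalities:
  \<open>1 / (1 - z) + 1 / (1 + z) = 2 / ((1 - z) * (1 + z))\<close>, and there is no circuit in \<open>{1 - z, 1 + z}\<close>.
\<close>


section \<open>Fractions and their supports\<close>

text \<open>
  A summand with numerator \<open>G\<close> and denominator \<open>\<Prod>\<^sub>j l\<^sub>j\<^bsup>q\<^sub>j\<^esup>\<close> is the pair \<open>(G, D)\<close>, where the
  multiset \<open>D\<close> of indices contains \<open>j\<close> exactly \<open>q\<^sub>j\<close> times. All \<open>l\<^sub>j\<close> have degree one, so
  \<open>size D\<close> is the total degree of the denominator.
\<close>

type_synonym 'd fraction = "'d cpoly \<times> nat multiset"

definition denom :: "(nat \<Rightarrow> 'd cpoly) \<Rightarrow> nat multiset \<Rightarrow> 'd cpoly"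
  where "denom l D = (\<Prod>j\<in>#D. l j)"

fun frac_val :: "(nat \<Rightarrow> 'd cpoly) \<Rightarrow> 'd::linorder fraction \<Rightarrow> 'd ratfun"
  where "frac_val l (G, D) = Fract G (denom l D)"

fun lowest_terms :: "(nat \<Rightarrow> 'd cpoly) \<Rightarrow> 'd fraction \<Rightarrow> bool"
  where "lowest_terms l (G, D) \<longleftrightarrow> (\<forall>j\<in>#D. \<not> l j dvd G)"

text \<open>
  For the families considered here the representation in lowest terms exists and its denominator is
  unique (the \<open>l\<^sub>j\<close> are irreducible and pairwise non-associated), and \<open>0\<close> has empty support.
\<close>

definition support :: "(nat \<Rightarrow> 'd cpoly) \<Rightarrow> nat \<Rightarrow> 'd::linorder ratfun \<Rightarrow> nat set"
  where "support l m f = {j. \<exists>G D. set_mset D \<subseteq> {1..m} \<and> lowest_terms l (G, D) \<and>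
    f = frac_val l (G, D) \<and> j \<in># D}"

definition no_broken_circuit_in_support ::
    "(nat \<Rightarrow> 'd cpoly) \<Rightarrow> nat \<Rightarrow> 'd::linorder fraction \<Rightarrow> bool"
  where "no_broken_circuit_in_support l m F \<longleftrightarrow>
    (\<forall>B. broken_circuit l m B \<longrightarrow> \<not> B \<subseteq> support l m (frac_val l F))"


section \<open>The algorithm SimpleDecomp\<close>

text \<open>
  SimpleDecomp is a nondeterministic transition system: every choice the algorithm leaves open
  (summand, broken circuit, dependence, polynomial combination, order of simplifications) is a
  choice of transition. A sum of rational functions is a multiset of fractions.
\<close>

text \<open>
  The dependence among \<open>l\<^sub>i\<close> and the \<open>l\<^sub>k\<close> with \<open>k \<in> B\<close> has \<open>a i \<noteq> 0\<close> because \<open>l ` B\<close> is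
  independent, but some other coefficients may vanish if \<open>i\<close> does not complete \<open>B\<close> to a circuit.
  The exchange identity then applies to the functions with nonzero coefficient.
\<close>

inductive exchange ::
    "(nat \<Rightarrow> 'd cpoly) \<Rightarrow> nat \<Rightarrow> 'd::linorder fraction multiset \<Rightarrow> 'd fraction multiset \<Rightarrow> bool"
  for l m where
  "exchange l m (add_mset (G, D) T)
     (image_mset (\<lambda>k. (pscale (- a k / a i) G, add_mset i D - {#k#})) (mset_set {k \<in> B. a k \<noteq> 0})
       + T)"
  if "broken_circuit l m B" and "B \<subseteq> support l m (frac_val l (G, D))"
    and "i \<in> {1..m}" and "\<forall>k\<in>B. k < i"
    and "(\<Sum>k\<in>insert i B. pscale (a k) (l k)) = 0" and "a i \<noteq> 0"

text \<open>
  Simplifying a fraction means passing to lowest terms in one go. Combining fractions that are only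
  partially cancelled must not be possible: it could undo an exchange and so reintroduce a broken
  circuit in a support.
\<close>

inductive collect ::
    "(nat \<Rightarrow> 'd cpoly) \<Rightarrow> 'd::linorder fraction multiset \<Rightarrow> 'd fraction multiset \<Rightarrow> bool"
  for l where
  combine: "collect l (add_mset (G, D) (add_mset (H, D) T)) (add_mset (G + H, D) T)"
| simplify: "collect l (add_mset (G, D) T) (add_mset (G', D') T)"
    if "\<not> lowest_terms l (G, D)" and "lowest_terms l (G', D')" and "D' \<subseteq># D"
      and "frac_val l (G', D') = frac_val l (G, D)"
| discard: "collect l (add_mset (0, D) T) T"

text \<open>
  This is only used when all summands are in lowest terms, so that \<open>set_mset D\<close> is the support.
\<close>

fun reducible :: "(nat \<Rightarrow> 'd cpoly) \<Rightarrow> 'd::linorder fraction \<Rightarrow> bool"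
  where "reducible l (G, D) \<longleftrightarrow> G \<in> ideal.span (l ` set_mset D)"

inductive expand ::
    "(nat \<Rightarrow> 'd cpoly) \<Rightarrow> 'd::linorder fraction multiset \<Rightarrow> 'd fraction multiset \<Rightarrow> bool"
  for l where
  "expand l (add_mset (G, D) T)
     (image_mset (\<lambda>j. (h j, D - {#j#})) (mset_set (set_mset D)) + T)"
  if "reducible l (G, D)"
    and "\<forall>(G', D')\<in>#T. reducible l (G', D') \<longrightarrow> size D' \<le> size D"
    and "G = (\<Sum>j\<in>set_mset D. h j * l j)"

datatype phase = Exchanging | Collecting | Expanding | Finished

inductive simple_decomp_step ::
    "(nat \<Rightarrow> 'd cpoly) \<Rightarrow> nat \<Rightarrow> phase \<times> 'd::linorder fraction multiset \<Rightarrow>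
      phase \<times> 'd fraction multiset \<Rightarrow> bool"
  for l m where
  "simple_decomp_step l m (Exchanging, S) (Exchanging, S')" if "exchange l m S S'"
| "simple_decomp_step l m (Exchanging, S) (Collecting, S)"
    if "\<forall>F\<in>#S. no_broken_circuit_in_support l m F"
| "simple_decomp_step l m (Collecting, S) (Collecting, S')" if "collect l S S'"
| "simple_decomp_step l m (Collecting, S) (Expanding, S)" if "\<nexists>S'. collect l S S'"
| "simple_decomp_step l m (Expanding, S) (Collecting, S')" if "expand l S S'"
| "simple_decomp_step l m (Expanding, S) (Finished, S)" if "\<forall>F\<in>#S. \<not> reducible l F"

definition simple_decomp_start ::
    "nat \<Rightarrow> 'd cpoly \<Rightarrow> (nat \<Rightarrow> nat) \<Rightarrow> phase \<times> 'd fraction multiset"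
  where "simple_decomp_start m G p = (Exchanging, {#(G, \<Sum>j\<in>{1..m}. replicate_mset (p j) j)#})"

definition simple_decomp_terminates ::
    "(nat \<Rightarrow> 'd cpoly) \<Rightarrow> nat \<Rightarrow> 'd::linorder cpoly \<Rightarrow> (nat \<Rightarrow> nat) \<Rightarrow> bool"
  where "simple_decomp_terminates l m G p \<longleftrightarrow>
    (\<nexists>run. run 0 = simple_decomp_start m G p \<and>
      (\<forall>n::nat. simple_decomp_step l m (run n) (run (Suc n)))) \<and>
    (\<forall>st. (simple_decomp_step l m)\<^sup>*\<^sup>* (simple_decomp_start m G p) st \<and>
      (\<nexists>st'. simple_decomp_step l m st st') \<longrightarrow> fst st = Finished)"

definition simple_decomp_output ::
    "(nat \<Rightarrow> 'd cpoly) \<Rightarrow> nat \<Rightarrow> 'd::linorder cpoly \<Rightarrow> (nat \<Rightarrow> nat) \<Rightarrow> 'd fraction multiset \<Rightarrow> bool"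
  where "simple_decomp_output l m G p S \<longleftrightarrow>
    (simple_decomp_step l m)\<^sup>*\<^sup>* (simple_decomp_start m G p) (Finished, S)"

end

theory Submission
  imports Defs "HOL-Computational_Algebra.Factorial_Ring"
begin

text \<open>
  Everything rests on one description of chi-independence. If \<open>C\<close> is a circuit with largest element
  \<open>j\<close>, then \<open>l\<^sub>j\<close> is a combination of the \<open>l\<^sub>k\<close> with \<open>k\<close> in the broken circuit; conversely, a
  relation expressing \<open>l\<^sub>j\<close> by smaller elements of \<open>I\<close> contains a circuit whose broken circuit lies
  in \<open>I\<close>. So a subset \<open>I\<close> of \<open>{1..m}\<close> is chi-independent iff no \<open>l\<^sub>j\<close> with \<open>j \<in> {1..m}\<close> is in the
  span of \<open>{l\<^sub>k | k \<in> I, k < j}\<close>.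

  Linear independence. Clearing denominators turns a relation among the reciprocals into
  \<open>\<Sum>\<^sub>I c\<^sub>I \<Prod>\<^sub>i\<^sub>\<notin>\<^sub>I l\<^sub>i = 0\<close>. All \<open>I\<close> have the same size, so all products have the same
  number of factors and the relation can be homogenized: the \<open>l\<^sub>i\<close> become linear forms \<open>f\<^sub>i\<close> in one
  more variable. Now remove the smallest index \<open>a\<close>
  (\<open>nbc_products_independent\<close>). On the hyperplane \<open>f\<^sub>a = 0\<close> only the terms with \<open>a \<in> I\<close> survive,
  and \<open>I - {a}\<close> is again chi-independent there (\<open>nbc_on_contract\<close>); hence these \<open>c\<^sub>I\<close> vanish by
  induction. The other terms have the common factor \<open>f\<^sub>a\<close>, which can be cancelled
  (\<open>cancel_linear_form\<close>), and the induction hypothesis applies once more. For this to work the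
  claim is stated on an arbitrary subspace, and without demanding that the \<open>f\<^sub>i\<close> remain distinct
  there: in a class of parallel forms the span condition singles out the largest index by itself.

  Spanning. If the support of a multiset \<open>A\<close> is not chi-independent, the exchange identity
  replaces \<open>A\<close> by multisets of the same size in which an index has been traded for a larger one
  (\<open>exchange_identity\<close>). The weight \<open>\<Sum>\<^sub>j\<^sub>\<in>\<^sub>A (m - j)\<close> drops, so this ends
  (\<open>exchange_weight_less\<close>).

  The algorithm. It terminates because each exchange lowers the multiset of these weights in the
  multiset order, and each collecting or expanding step lowers the multiset of degrees of
  the denominators. The sum of the fractions never changes. What needs care is that no broken
  circuit comes back. The \<open>l\<^sub>j\<close> are prime and pairwise non-associated, so the support of
  \<open>G / D\<close> is contained in the set of indices of \<open>D\<close>, with equality in lowest terms. During the exchanges all numerators are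
  nonzero multiples of the input numerator \<open>G\<^sub>0\<close>. Afterwards every fraction \<open>(G, D)\<close> either has a
  chi-independent \<open>D\<close>, or \<open>G\<close> is a multiple of \<open>G\<^sub>0\<close> and the support of \<open>G\<^sub>0 / D\<close> contains no
  broken circuit (\<open>collected\<close>). Combining preserves this, as it involves a single \<open>D\<close>, and passing
  to lowest terms leads to the first case (\<open>lowest_terms_collected\<close>). So once collecting has ended
  all denominators are chi-independent, and expanding only makes them smaller.
\<close>

section \<open>Substitution into polynomials\<close>

text \<open>
  The rule \<open>a * (b * c) = (a * b) * c\<close> would work against \<open>mult.assoc\<close> in every commutative ring.
\<close>
declare ideal.scale_scale [simp del]

text \<open>
  The coefficients are mapped by \<open>h\<close>, so that evaluation at a point and substitution of polynomials
  for the variables are both instances.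
\<close>
locale substitution =
  fixes h :: "complex \<Rightarrow> 'r::comm_ring_1" and x :: "'d::finite \<Rightarrow> 'r"
  assumes h_add: "h (c + c') = h c + h c'"
    and h_mult: "h (c * c') = h c * h c'"
    and h_1: "h 1 = 1"
begin

lemma h_0: "h 0 = 0"
  using h_add[of 0 0] by simp

definition subst :: "'d cpoly \<Rightarrow> 'r"
  where "subst p = (\<Sum>e\<in>Poly_Mapping.keys p. h (Poly_Mapping.lookup p e) * (\<Prod>i\<in>UNIV. x i ^ Poly_Mapping.lookup e i))"

lemma subst_superset:
  assumes "finite E" and "Poly_Mapping.keys p \<subseteq> E"
  shows "subst p = (\<Sum>e\<in>E. h (Poly_Mapping.lookup p e) * (\<Prod>i\<in>UNIV. x i ^ Poly_Mapping.lookup e i))"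
  unfolding subst_def
  by (rule sum.mono_neutral_left) (use assms in \<open>auto simp: in_keys_iff h_0\<close>)

lemma subst_add: "subst (p + q) = subst p + subst q"
proof -
  have fin: "finite (Poly_Mapping.keys p \<union> Poly_Mapping.keys q)" by simp
  show ?thesis
    by (simp add: subst_superset[OF fin keys_add] subst_superset[OF fin, of p]
        subst_superset[OF fin, of q] lookup_add h_add distrib_right sum.distrib)
qed

lemma subst_0: "subst 0 = 0"
  by (simp add: subst_def)

lemma subst_single: "subst (Poly_Mapping.single e c) = h c * (\<Prod>i\<in>UNIV. x i ^ Poly_Mapping.lookup e i)"
  by (simp add: subst_def h_0)

lemma subst_Const: "subst (Const c) = h c"
  by (simp add: Const_def subst_single)

lemma subst_1: "subst 1 = 1"
  by (simp add: subst_Const h_1 flip: Const_1)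

lemma subst_Var: "subst (Var i) = x i"
proof -
  have "(\<Prod>j\<in>UNIV. x j ^ Poly_Mapping.lookup (Poly_Mapping.single i (1::nat)) j) = (\<Prod>j\<in>UNIV. if j = i then x i else 1)"
    by (rule prod.cong) (auto simp: lookup_single when_def)
  then show ?thesis
    by (simp add: Var_def subst_single h_1)
qed

end

lemma cpoly_decompose:
  "(p :: 'd cpoly) = (\<Sum>e\<in>Poly_Mapping.keys p. Poly_Mapping.single e (Poly_Mapping.lookup p e))"
  by (rule poly_mapping_eqI) (auto simp: lookup_sum lookup_single when_def sum.delta' in_keys_iff)

lemma cpoly_additive_induct [case_names single add]:
  fixes p :: "'d cpoly"
  assumes single: "\<And>e c. P (Poly_Mapping.single e c)"
    and add: "\<And>p q. P p \<Longrightarrow> P q \<Longrightarrow> P (p + q)"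
  shows "P p"
proof -
  have "P (\<Sum>e\<in>E. Poly_Mapping.single e (Poly_Mapping.lookup p e))" if "finite E" for E
    using that
  proof induction
    case empty
    show ?case using single[of 0 0] by simp
  qed (simp add: assms)
  then have "P (\<Sum>e\<in>Poly_Mapping.keys p. Poly_Mapping.single e (Poly_Mapping.lookup p e))" by simp
  then show ?thesis by (rule ssubst[where P = P, OF cpoly_decompose])
qed

context substitution
begin

lemma subst_mult: "subst (p * q) = subst p * subst q"
proof (induction p rule: cpoly_additive_induct)
  case (single e c)
  show ?case
  proof (induction q rule: cpoly_additive_induct)
    case (single e' c')
    show ?case
      unfolding mult_single subst_single h_mult lookup_add power_add prod.distrib
      by (simp only: mult.assoc mult.left_commute)
  qed (simp add: distrib_left subst_add)
qed (simp add: distrib_right subst_add)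

lemma subst_uminus: "subst (- p) = - subst p"
proof -
  have "subst (- p) + subst p = 0"
    by (simp add: subst_0 flip: subst_add)
  then show ?thesis by (simp add: eq_neg_iff_add_eq_0)
qed

lemma subst_diff: "subst (p - q) = subst p - subst q"
  using subst_add[of p "- q"] by (simp add: subst_uminus)

lemma subst_sum: "subst (\<Sum>a\<in>S. f a) = (\<Sum>a\<in>S. subst (f a))"
  by (induction S rule: infinite_finite_induct) (simp_all add: subst_0 subst_add)

lemma subst_prod: "subst (\<Prod>a\<in>S. f a) = (\<Prod>a\<in>S. subst (f a))"
  by (induction S rule: infinite_finite_induct) (simp_all add: subst_1 subst_mult)

lemma subst_linear_function:
  "subst (linear_function b) = 1 - (\<Sum>i\<in>UNIV. h (complex_of_real (b $ i)) * x i)"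
  by (simp add: linear_function_def subst_diff subst_1 subst_sum subst_mult subst_Const subst_Var)

end

lemma single_eq_monomial:
  fixes e :: "'d::finite \<Rightarrow>\<^sub>0 nat"
  shows "Poly_Mapping.single e c = Const c * (\<Prod>i\<in>UNIV. Var i ^ Poly_Mapping.lookup e i)"
proof -
  have Var_power: "Var i ^ n = Poly_Mapping.single (Poly_Mapping.single i n) 1" for i :: 'd and n
    by (induction n) (simp_all add: Var_def mult_single single_add[symmetric])
  have "(\<Prod>i\<in>S. Var i ^ Poly_Mapping.lookup e i)
      = Poly_Mapping.single (\<Sum>i\<in>S. Poly_Mapping.single i (Poly_Mapping.lookup e i)) 1" for S :: "'d set"
    by (induction S rule: infinite_finite_induct) (simp_all add: Var_power mult_single)
  moreover have "(\<Sum>i\<in>UNIV. Poly_Mapping.single i (Poly_Mapping.lookup e i)) = e"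
    by (rule poly_mapping_eqI) (simp add: lookup_sum lookup_single when_def)
  ultimately show ?thesis by (simp add: Const_def mult_single)
qed

global_interpretation cpoly_subst: substitution Const "x :: 'd \<Rightarrow> 'd::finite cpoly" for x
  defines cpoly_subst = cpoly_subst.subst
  by unfold_locales (simp_all add: Const_add Const_mult Const_1)

global_interpretation point_eval: substitution "\<lambda>c. c" "z :: 'd::finite \<Rightarrow> complex" for z
  defines point_eval = point_eval.subst
  by unfold_locales simp_all

text \<open>
  Congruence modulo \<open>q\<close> is compatible with sums and products, so it is enough to have it for the
  variables.
\<close>
lemma dvd_diff_cpoly_subst:
  fixes q :: "'d::finite cpoly"
  assumes "\<And>i. q dvd Var i - x i"
  shows "q dvd p - cpoly_subst x p"
proof (induction p rule: cpoly_additive_induct)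
  case (single e c)
  have mult: "q dvd a * a' - b * b'" if "q dvd a - b" "q dvd a' - b'" for a a' b b'
  proof -
    have "a * a' - b * b' = (a - b) * a' + b * (a' - b')" by (simp add: algebra_simps)
    then show ?thesis using that by simp
  qed
  have pow: "q dvd Var i ^ n - x i ^ n" for i n
    by (induction n) (auto intro: mult assms)
  have "q dvd (\<Prod>i\<in>S. Var i ^ Poly_Mapping.lookup e i) - (\<Prod>i\<in>S. x i ^ Poly_Mapping.lookup e i)" for S
    by (induction S rule: infinite_finite_induct) (auto intro: mult pow)
  then show ?case
    by (simp add: single_eq_monomial[of e c] cpoly_subst.subst_single[of x e c, unfolded single_eq_monomial[of e c]] mult)
next
  case (add p p')
  have "p + p' - cpoly_subst x (p + p') = (p - cpoly_subst x p) + (p' - cpoly_subst x p')"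
    by (simp add: cpoly_subst.subst_add)
  then show ?case using add by (metis dvd_add)
qed

text \<open>
  Some variable occurs in the linear function; the substitution solves \<open>linear_function b = 0\<close> for it.
  A polynomial and its image are congruent modulo \<open>linear_function b\<close>, so the kernel is the ideal
  generated by \<open>linear_function b\<close>. That ideal is therefore prime.
\<close>
lemma linear_function_subst_kernel:
  assumes "b \<noteq> 0"
  shows "\<exists>x. \<forall>p. linear_function b dvd p \<longleftrightarrow> cpoly_subst x p = 0"
proof -
  obtain i where i: "b $ i \<noteq> 0" using assms by (auto simp: vec_eq_iff)
  \<comment> \<open>the root of \<open>linear_function b\<close> in the variable \<open>i\<close>, written without a division\<close>
  define x where "x = Var(i := Var i + Const (1 / complex_of_real (b $ i)) * linear_function b)"
  have Ci: "Const (complex_of_real (b $ i)) * Const (1 / complex_of_real (b $ i)) = 1"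
    using i by (simp add: Const_1 flip: Const_mult)
  have "(\<Sum>j\<in>UNIV. Const (complex_of_real (b $ j)) * x j)
      = (\<Sum>j\<in>UNIV. Const (complex_of_real (b $ j)) * Var j + (if j = i then linear_function b else 0))"
    by (rule sum.cong) (simp_all add: x_def distrib_left Ci flip: mult.assoc)
  also have "\<dots> = 1"
    by (simp add: sum.distrib) (simp add: linear_function_def)
  finally have zero: "cpoly_subst x (linear_function b) = 0"
    by (simp add: cpoly_subst.subst_linear_function)
  have dvd: "linear_function b dvd p - cpoly_subst x p" for p
    by (rule dvd_diff_cpoly_subst) (auto simp: x_def)
  have "linear_function b dvd p \<longleftrightarrow> cpoly_subst x p = 0" for p
  proof
    assume "linear_function b dvd p"
    then obtain q where "p = linear_function b * q" ..
    then show "cpoly_subst x p = 0" by (simp add: cpoly_subst.subst_mult zero)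
  next
    assume "cpoly_subst x p = 0"
    then show "linear_function b dvd p" using dvd[of p] by simp
  qed
  then show ?thesis by blast
qed

lemma linear_function_nonzero: "linear_function b \<noteq> 0"
proof
  assume "linear_function b = 0"
  then have "point_eval (\<lambda>_. 0) (linear_function b) = 0" by (simp add: point_eval.subst_0)
  then show False by (simp add: point_eval.subst_linear_function)
qed

lemma prime_elem_linear_function:
  fixes b :: "real ^ ('d::{finite,linorder})"
  assumes "b \<noteq> 0"
  shows "prime_elem (linear_function b)"
proof -
  obtain x where x: "\<And>p. linear_function b dvd p \<longleftrightarrow> cpoly_subst x p = 0"
    using linear_function_subst_kernel[OF assms] by blast
  have "cpoly_subst x 1 \<noteq> 0" by (simp add: cpoly_subst.subst_1)
  then show ?thesis
    by (auto simp: prime_elem_def linear_function_nonzero x cpoly_subst.subst_mult)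
qed

text \<open>
  Divisibility makes the zero set of the first function part of that of the second. The coefficients
  can then be read off at the zeros supported on one or two coordinate axes; the constant terms are
  both \<open>1\<close>, so proportional functions are equal.
\<close>
lemma linear_function_dvd_imp_eq:
  fixes b b' :: "real ^ 'd::finite"
  assumes "b \<noteq> 0" and dvd: "linear_function b dvd linear_function b'"
  shows "b' = b"
proof -
  obtain i where i: "b $ i \<noteq> 0" using assms by (auto simp: vec_eq_iff)
  have vanish: "(\<Sum>k\<in>UNIV. of_real (b' $ k) * z k) = 1"
    if "(\<Sum>k\<in>UNIV. of_real (b $ k) * z k) = 1" for z :: "'d \<Rightarrow> complex"
  proof -
    obtain q where "linear_function b' = linear_function b * q" using dvd ..
    then have "point_eval z (linear_function b') = 0"
      using that by (simp add: point_eval.subst_mult point_eval.subst_linear_function)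
    then show ?thesis by (simp add: point_eval.subst_linear_function)
  qed
  have sum_two: "(\<Sum>k\<in>UNIV. of_real (c $ k) * ((if k = i then s else 0) + (if k = t then r else 0)))
      = of_real (c $ i) * s + of_real (c $ t) * (r :: complex)" for c :: "real ^ 'd" and s r t
  proof -
    have delta: "(\<Sum>k\<in>UNIV. of_real (c $ k) * (if k = j then r else 0)) = of_real (c $ j) * r"
      for j and r :: complex
      by (subst sum.remove[of _ j]) auto
    show ?thesis by (simp only: distrib_left sum.distrib delta)
  qed
  \<comment> \<open>the zero on the \<open>i\<close>-th axis\<close>
  have bi: "b' $ i = b $ i"
    using vanish[of "\<lambda>k. (if k = i then 1 / of_real (b $ i) else 0) + (if k = i then 0 else 0)"] i
    unfolding sum_two by (simp add: field_simps)
  show ?thesis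
  proof (unfold vec_eq_iff, rule allI)
    fix t
    show "b' $ t = b $ t"
      \<comment> \<open>the zero on the line through the \<open>t\<close>-th unit vector in direction \<open>i\<close>\<close>
      using vanish[of "\<lambda>k. (if k = i then (1 - of_real (b $ t)) / of_real (b $ i) else 0)
          + (if k = t then 1 else 0)"] i
      unfolding sum_two by (simp add: bi)
  qed
qed

section \<open>Products of linear forms on subspaces\<close>

text \<open>
  The induction below passes to hyperplanes again and again. Working with subsets of one fixed space
  of points and with functions on all of it avoids changing the number of variables.
\<close>
definition linear_form :: "(('x \<Rightarrow> complex) \<Rightarrow> complex) \<Rightarrow> bool"
  where "linear_form g \<longleftrightarrow> (\<forall>z w t. g (\<lambda>x. z x + t * w x) = g z + t * g w)"

definition point_subspace :: "('x \<Rightarrow> complex) set \<Rightarrow> bool"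
  where "point_subspace W \<longleftrightarrow> W \<noteq> {} \<and> (\<forall>z\<in>W. \<forall>w\<in>W. \<forall>t. (\<lambda>x. z x + t * w x) \<in> W)"

lemma linear_formD: "linear_form g \<Longrightarrow> g (\<lambda>x. z x + t * w x) = g z + t * g w"
  by (simp add: linear_form_def)

lemma point_subspaceD: "point_subspace W \<Longrightarrow> z \<in> W \<Longrightarrow> w \<in> W \<Longrightarrow> (\<lambda>x. z x + t * w x) \<in> W"
  by (simp add: point_subspace_def)

lemma point_subspace_kernel:
  assumes W: "point_subspace W" and g: "linear_form g"
  shows "point_subspace {z \<in> W. g z = 0}"
proof -
  obtain z where z: "z \<in> W" using W by (auto simp: point_subspace_def)
  have "(\<lambda>x. z x + (- 1) * z x) \<in> W" by (rule point_subspaceD[OF W z z])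
  moreover have "g (\<lambda>x. z x + (- 1) * z x) = 0" unfolding linear_formD[OF g] by simp
  ultimately show ?thesis
    unfolding point_subspace_def using point_subspaceD[OF W] linear_formD[OF g] by auto
qed

text \<open>
  At a zero \<open>z\<close> of \<open>g\<close>, move along the line in a direction \<open>w\<close> with \<open>g w \<noteq> 0\<close>: the sum vanishes at
  all other points of the line, hence by continuity at \<open>z\<close>.
\<close>
lemma cancel_linear_form:
  fixes f :: "nat \<Rightarrow> ('x \<Rightarrow> complex) \<Rightarrow> complex"
  assumes W: "point_subspace W" and g: "linear_form g"
    and f: "\<And>I i. I \<in> S \<Longrightarrow> i \<in> N I \<Longrightarrow> linear_form (f i)"
    and w: "w \<in> W" "g w \<noteq> 0"
    and zero: "\<And>z. z \<in> W \<Longrightarrow> g z * (\<Sum>I\<in>S. c I * (\<Prod>i\<in>N I. f i z)) = 0"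
    and z: "z \<in> W"
  shows "(\<Sum>I\<in>S. c I * (\<Prod>i\<in>N I. f i z)) = 0"
proof (cases "g z = 0")
  case True
  define \<phi> where "\<phi> t = (\<Sum>I\<in>S. c I * (\<Prod>i\<in>N I. f i z + t * f i w))" for t
  have "\<phi> t = 0" if "t \<noteq> 0" for t
  proof -
    have "(\<Sum>I\<in>S. c I * (\<Prod>i\<in>N I. f i (\<lambda>x. z x + t * w x))) = \<phi> t"
      unfolding \<phi>_def by (intro sum.cong arg_cong2[where f = "(*)"] prod.cong refl linear_formD f)
    then show ?thesis
      using zero[OF point_subspaceD[OF W z w(1), of t]] True that w(2)
      by (simp add: linear_formD[OF g])
  qed
  then have "(\<phi> \<longlongrightarrow> 0) (at 0)"
    by (intro tendsto_eventually) (simp add: eventually_at_filter)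
  moreover have "(\<phi> \<longlongrightarrow> \<phi> 0) (at 0)"
    unfolding \<phi>_def by (intro tendsto_intros)
  ultimately have "\<phi> 0 = 0"
    using LIM_unique by blast
  then show ?thesis by (simp add: \<phi>_def)
qed (use zero[OF z] in simp)

text \<open>
  The span description of sets without broken circuits, for the restrictions of the forms to \<open>W\<close>.
\<close>
definition nbc_on :: "(nat \<Rightarrow> ('x \<Rightarrow> complex) \<Rightarrow> complex) \<Rightarrow> ('x \<Rightarrow> complex) set \<Rightarrow> nat set \<Rightarrow> nat set \<Rightarrow> bool"
  where "nbc_on f W A I \<longleftrightarrow>
    (\<forall>j\<in>A. \<nexists>q. \<forall>z\<in>W. f j z = (\<Sum>k\<in>{k \<in> I. k < j}. q k * f k z))"

text \<open>
  A form that vanishes on the hyperplane \<open>f a = 0\<close> of \<open>W\<close> is a multiple of \<open>f a\<close> on \<open>W\<close>. Since \<open>a\<close> is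
  smaller than all other indices, adding a multiple of \<open>f a\<close> to a relation that uses only indices
  below \<open>j\<close> gives another such relation.
\<close>
lemma nbc_on_contract:
  assumes W: "point_subspace W" and f: "\<And>i. i \<in> insert a A \<Longrightarrow> linear_form (f i)"
    and a: "\<And>i. i \<in> A \<Longrightarrow> a < i" and w: "w \<in> W" "f a w \<noteq> 0"
    and "finite A" and I: "I \<subseteq> A" and nbc: "nbc_on f W (insert a A) (insert a I)"
  shows "nbc_on f {z \<in> W. f a z = 0} A I"
  unfolding nbc_on_def
proof (intro ballI notI)
  fix j assume j: "j \<in> A"
  assume "\<exists>q. \<forall>z\<in>{z \<in> W. f a z = 0}. f j z = (\<Sum>k\<in>{k \<in> I. k < j}. q k * f k z)"
  then obtain q where q: "\<And>z. z \<in> W \<Longrightarrow> f a z = 0 \<Longrightarrow> f j z = (\<Sum>k\<in>{k \<in> I. k < j}. q k * f k z)"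
    by blast
  define J where "J = {k \<in> I. k < j}"
  define D where "D z = f j z - (\<Sum>k\<in>J. q k * f k z)" for z
  have D: "linear_form D"
    unfolding linear_form_def D_def
  proof (intro allI)
    fix z w t
    have lin: "f k (\<lambda>x. z x + t * w x) = f k z + t * f k w" if "k \<in> insert j J" for k
      using f that I j by (intro linear_formD) (auto simp: J_def)
    have "(\<Sum>k\<in>J. q k * f k (\<lambda>x. z x + t * w x)) = (\<Sum>k\<in>J. q k * f k z + t * (q k * f k w))"
      by (rule sum.cong) (simp_all add: lin distrib_left mult.left_commute)
    also have "\<dots> = (\<Sum>k\<in>J. q k * f k z) + t * (\<Sum>k\<in>J. q k * f k w)"
      by (simp add: sum.distrib sum_distrib_left)
    finally show "f j (\<lambda>x. z x + t * w x) - (\<Sum>k\<in>J. q k * f k (\<lambda>x. z x + t * w x)) =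
        f j z - (\<Sum>k\<in>J. q k * f k z) + t * (f j w - (\<Sum>k\<in>J. q k * f k w))"
      unfolding lin[OF insertI1] by (simp add: right_diff_distrib)
  qed
  have "f j z = (\<Sum>k\<in>{k \<in> insert a I. k < j}. (q(a := D w / f a w)) k * f k z)" if z: "z \<in> W" for z
  proof -
    \<comment> \<open>project \<open>z\<close> onto the hyperplane along \<open>w\<close>\<close>
    define t where "t = - (f a z / f a w)"
    have "f a (\<lambda>x. z x + t * w x) = f a z + t * f a w"
      by (intro linear_formD f) simp
    then have "f a (\<lambda>x. z x + t * w x) = 0"
      using w(2) by (simp add: t_def)
    then have "D (\<lambda>x. z x + t * w x) = 0"
      using q point_subspaceD[OF W z w(1), of t] by (simp add: D_def J_def)
    then have "D z + t * D w = 0"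
      by (simp only: linear_formD[OF D])
    then have "D z = D w / f a w * f a z"
      by (simp add: t_def)
    moreover have "{k \<in> insert a I. k < j} = insert a J" and "a \<notin> J" and "finite J"
      using a[OF j] a I \<open>finite A\<close> by (auto simp: J_def intro: finite_subset)
    moreover have "(\<Sum>k\<in>J. (q(a := D w / f a w)) k * f k z) = (\<Sum>k\<in>J. q k * f k z)"
      by (rule sum.cong) (use \<open>a \<notin> J\<close> in auto)
    ultimately show ?thesis by (simp add: D_def algebra_simps)
  qed
  then show False
    using nbc j unfolding nbc_on_def by blast
qed

text \<open>
  Deletion and restriction with respect to the smallest index \<open>a\<close>. The relation has the form
  \<open>f a * P + Q = 0\<close>, where \<open>P\<close> collects the sets without \<open>a\<close> and \<open>Q\<close> those with \<open>a\<close>. Only \<open>Q\<close> is left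
  where \<open>f a = 0\<close>; once it is known to be zero, \<open>f a\<close> cancels.
\<close>
lemma nbc_products_independent:
  fixes f :: "nat \<Rightarrow> ('x \<Rightarrow> complex) \<Rightarrow> complex"
  assumes "finite A" and "point_subspace W" and "\<And>i. i \<in> A \<Longrightarrow> linear_form (f i)"
    and "\<And>z. z \<in> W \<Longrightarrow> (\<Sum>I\<in>Pow A. c I * (\<Prod>i\<in>A - I. f i z)) = 0"
    and "\<And>I. I \<subseteq> A \<Longrightarrow> c I \<noteq> 0 \<Longrightarrow> nbc_on f W A I"
    and "I \<subseteq> A"
  shows "c I = 0"
  using assms
proof (induction A arbitrary: W c I rule: finite_linorder_min_induct)
  case empty
  then obtain z where "z \<in> W" by (auto simp: point_subspace_def)
  then show ?case using empty by simp
next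
  case (insert a A)
  note W = insert.prems(1) and f = insert.prems(2) and zero = insert.prems(3) and nbc = insert.prems(4)
  have a: "a \<notin> A" using insert.hyps by blast
  show ?case
  proof (cases "\<forall>z\<in>W. f a z = 0")
    case True
    then have "\<not> nbc_on f W (insert a A) I"
      by (auto simp: nbc_on_def intro: exI[of _ "\<lambda>_. 0"])
    then show ?thesis using nbc insert.prems(5) by blast
  next
    case False
    then obtain w where w: "w \<in> W" "f a w \<noteq> 0" by blast
    define P where "P z = (\<Sum>I\<in>Pow A. c I * (\<Prod>i\<in>A - I. f i z))" for z
    define Q where "Q z = (\<Sum>I\<in>Pow A. c (insert a I) * (\<Prod>i\<in>A - I. f i z))" for z
    have PQ: "f a z * P z + Q z = 0" if "z \<in> W" for z
    proof -
      have "(\<Sum>I\<in>Pow (insert a A). c I * (\<Prod>i\<in>insert a A - I. f i z))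
          = (\<Sum>I\<in>Pow A. c I * (\<Prod>i\<in>insert a A - I. f i z))
          + (\<Sum>I\<in>insert a ` Pow A. c I * (\<Prod>i\<in>insert a A - I. f i z))"
        unfolding Pow_insert by (rule sum.union_disjoint) (use insert.hyps a in auto)
      also have "(\<Sum>I\<in>Pow A. c I * (\<Prod>i\<in>insert a A - I. f i z)) = f a z * P z"
        unfolding P_def sum_distrib_left
      proof (rule sum.cong[OF refl])
        fix I assume "I \<in> Pow A"
        then have "insert a A - I = insert a (A - I)" using a by auto
        then show "c I * (\<Prod>i\<in>insert a A - I. f i z) = f a z * (c I * (\<Prod>i\<in>A - I. f i z))"
          using insert.hyps(1) a by simp
      qed
      also have "(\<Sum>I\<in>insert a ` Pow A. c I * (\<Prod>i\<in>insert a A - I. f i z)) = Q z"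
      proof -
        have "inj_on (insert a) (Pow A)" using a by (auto simp: inj_on_def)
        moreover have "insert a A - insert a I = A - I" for I using a by auto
        ultimately show ?thesis by (simp add: sum.reindex Q_def)
      qed
      finally show ?thesis using zero[OF that] by simp
    qed
    have ca: "c (insert a I) = 0" if "I \<subseteq> A" for I
    proof (rule insert.IH[of "{z \<in> W. f a z = 0}" "\<lambda>I. c (insert a I)"])
      show "point_subspace {z \<in> W. f a z = 0}" by (intro point_subspace_kernel W f) simp
      show "(\<Sum>I\<in>Pow A. c (insert a I) * (\<Prod>i\<in>A - I. f i z)) = 0" if "z \<in> {z \<in> W. f a z = 0}" for z
        using PQ[of z] that by (simp add: Q_def)
      show "nbc_on f {z \<in> W. f a z = 0} A I" if "I \<subseteq> A" "c (insert a I) \<noteq> 0" for I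
        using that insert.hyps by (intro nbc_on_contract[where w = w] W f w nbc) auto
    qed (use f that in auto)
    then have "Q z = 0" for z by (simp add: Q_def)
    then have fP: "f a z * P z = 0" if "z \<in> W" for z using PQ[OF that] by simp
    have c: "c I = 0" if "I \<subseteq> A" for I
    proof (rule insert.IH[of W c])
      show "(\<Sum>I\<in>Pow A. c I * (\<Prod>i\<in>A - I. f i z)) = 0" if "z \<in> W" for z
        by (rule cancel_linear_form[where N = "\<lambda>I. A - I" and W = W and g = "f a" and w = w])
          (use W f w fP that in \<open>auto simp: P_def\<close>)
      show "nbc_on f W A I" if "I \<subseteq> A" "c I \<noteq> 0" for I
        using nbc[of I] that by (auto simp: nbc_on_def)
    qed (use W f that in auto)
    show ?thesis
    proof (cases "a \<in> I")
      case True
      then have "I = insert a (I - {a})" "I - {a} \<subseteq> A" using insert.prems(5) by auto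
      then show ?thesis using ca by metis
    qed (use c insert.prems(5) in blast)
  qed
qed

section \<open>Families of linear functions and their broken circuits\<close>

lemma Fract_sum: "Fract (\<Sum>a\<in>S. f a) d = (\<Sum>a\<in>S. Fract (f a) d)"
proof (cases "d = 0")
  case False
  have "Fract (f a + c) d = Fract (f a) d + Fract c d" for a c
    using False by (simp add: eq_fract algebra_simps)
  then show ?thesis
    by (induction S rule: infinite_finite_induct) (simp_all add: fract_collapse)
qed (simp add: fract_collapse)

lemma Fract_prod: "Fract (\<Prod>a\<in>S. f a) 1 = (\<Prod>a\<in>S. Fract (f a) 1)"
proof (induction S rule: infinite_finite_induct)
  case (insert a S)
  have "Fract (f a * (\<Prod>a\<in>S. f a)) 1 = Fract (f a) 1 * Fract (\<Prod>a\<in>S. f a) 1"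
    by simp
  then show ?case
    unfolding insert.IH using insert.hyps by simp
qed (simp_all add: One_fract_def)

locale linear_functions =
  fixes b :: "nat \<Rightarrow> real ^ ('d::{finite,linorder})" and l :: "nat \<Rightarrow> 'd cpoly" and m :: nat
  assumes b_nonzero: "\<And>j. j \<in> {1..m} \<Longrightarrow> b j \<noteq> 0"
    and l_eq: "\<And>j. j \<in> {1..m} \<Longrightarrow> l j = linear_function (b j)"
    and inj_l: "inj_on l {1..m}"
begin

lemma l_nonzero: "j \<in> {1..m} \<Longrightarrow> l j \<noteq> 0"
  by (simp add: l_eq linear_function_nonzero)

lemma prime_elem_l: "j \<in> {1..m} \<Longrightarrow> prime_elem (l j)"
  by (simp add: l_eq prime_elem_linear_function b_nonzero)

lemma l_dvd_l_imp_eq: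
  assumes "j \<in> {1..m}" and "k \<in> {1..m}" and "l j dvd l k"
  shows "j = k"
proof -
  have "b k = b j"
    using assms by (intro linear_function_dvd_imp_eq) (simp_all add: b_nonzero l_eq)
  then show ?thesis
    using assms inj_onD[OF inj_l, of j k] by (simp add: l_eq)
qed

lemma span_l_combination:
  assumes "B \<subseteq> {1..m}" and "v \<in> cpoly.span (l ` B)"
  obtains q where "v = (\<Sum>k\<in>B. pscale (q k) (l k))"
proof -
  have "finite B" and "inj_on l B"
    using assms inj_l by (auto intro: finite_subset inj_on_subset)
  then obtain u where "v = (\<Sum>w\<in>l ` B. pscale (u w) w)"
    using assms by (auto simp: cpoly.span_finite)
  then show thesis
    using that[of "u \<circ> l"] \<open>inj_on l B\<close> by (simp add: sum.reindex)
qed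

lemma broken_circuit_completion:
  assumes "broken_circuit l m B"
  obtains i where "i \<in> {1..m}" and "\<forall>k\<in>B. k < i" and "B \<subseteq> {1..m}"
    and "l i \<in> cpoly.span (l ` B)"
proof -
  obtain C where C: "C \<subseteq> {1..m}" "cpoly.dependent (l ` C)"
      "\<And>C'. C' \<subset> C \<Longrightarrow> cpoly.independent (l ` C')" "B = C - {Max C}"
    using assms by (auto simp: broken_circuit_def circuit_def)
  have fin: "finite C" and "C \<noteq> {}"
    using C(1,2) cpoly.independent_empty by (auto intro: finite_subset)
  then have Max: "Max C \<in> C" by simp
  then have "l ` C = insert (l (Max C)) (l ` B)" and "B \<subset> C"
    using C(4) by auto
  then have "l (Max C) \<in> cpoly.span (l ` B)"
    using C(2,3) by (metis cpoly.independent_insertI)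
  moreover have "\<forall>k\<in>B. k < Max C"
    using fin C(4) by (auto simp: order_less_le)
  ultimately show thesis
    using that C(1,4) Max by blast
qed

text \<open>
  A minimal dependent subset of \<open>{k \<in> I. k < j} \<union> {j}\<close> is a circuit. Whether or not it contains \<open>j\<close>,
  removing its largest element leaves a subset of \<open>I\<close>.
\<close>
lemma chi_independent_not_in_span:
  assumes chi: "chi_independent l m I" and j: "j \<in> {1..m}"
  shows "l j \<notin> cpoly.span (l ` {k \<in> I. k < j})"
proof
  define K where "K = {k \<in> I. k < j}"
  assume "l j \<in> cpoly.span (l ` {k \<in> I. k < j})"
  moreover have I: "I \<subseteq> {1..m}" using chi by (simp add: chi_independent_def)
  moreover have "l j \<notin> l ` K"
    using I j inj_on_image_mem_iff[OF inj_l, of j K] by (auto simp: K_def)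
  ultimately have dep: "cpoly.dependent (l ` insert j K)"
    unfolding cpoly.dependent_def by (intro bexI[of _ "l j"]) (auto simp: K_def)
  define \<D> where "\<D> = {C. C \<subseteq> insert j K \<and> cpoly.dependent (l ` C)}"
  have "finite K"
    by (rule finite_subset[of _ "{1..m}"]) (use I in \<open>auto simp: K_def\<close>)
  then have fin: "finite \<D>" by (simp add: \<D>_def)
  have ne: "\<D> \<noteq> {}" using dep by (auto simp: \<D>_def)
  obtain C where "C \<in> \<D>" and "\<forall>C'\<in>\<D>. C' \<subseteq> C \<longrightarrow> C = C'"
    using finite_has_minimal[OF fin ne] by blast
  then have C: "C \<subseteq> insert j K" "cpoly.dependent (l ` C)"
    and min: "\<And>C'. C' \<subseteq> C \<Longrightarrow> cpoly.dependent (l ` C') \<Longrightarrow> C = C'"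
    by (auto simp: \<D>_def)
  have "circuit l m C"
    unfolding circuit_def
  proof (intro conjI allI impI)
    show "C \<subseteq> {1..m}" using C I j by (auto simp: K_def)
    show "cpoly.dependent (l ` C)" by (rule C)
    show "cpoly.independent (l ` C')" if "C' \<subset> C" for C'
      using min[of C'] that C by blast
  qed
  moreover have "C - {Max C} \<subseteq> I"
  proof (cases "j \<in> C")
    case True
    then have "Max C = j"
      using finite_subset[OF C(1)] C(1) \<open>finite K\<close>
      by (intro Max_eqI) (auto simp: K_def)
    then show ?thesis using C(1) by (auto simp: K_def)
  qed (use C(1) in \<open>auto simp: K_def\<close>)
  ultimately show False
    using chi by (auto simp: chi_independent_def broken_circuit_def)
qed

section \<open>Linear independence of the reciprocals\<close>

text \<open>
  The coordinate \<open>None\<close> is the homogenizing variable.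
\<close>
definition homogenization :: "nat \<Rightarrow> ('d option \<Rightarrow> complex) \<Rightarrow> complex"
  where "homogenization j z = z None - (\<Sum>t\<in>UNIV. complex_of_real (b j $ t) * z (Some t))"

lemma linear_form_homogenization: "linear_form (homogenization j)"
  by (simp add: linear_form_def homogenization_def sum.distrib sum_distrib_left
      distrib_left right_diff_distrib mult.left_commute)

lemma homogenization_eq_point_eval:
  assumes "z None \<noteq> 0" and "j \<in> {1..m}"
  shows "homogenization j z = z None * point_eval (\<lambda>t. z (Some t) / z None) (l j)"
  using assms by (simp add: homogenization_def l_eq point_eval.subst_linear_function
      right_diff_distrib sum_distrib_left mult.left_commute)

text \<open>
  Homogenization loses nothing: the constant term and the coefficients of \<open>l j\<close> are the values of
  its homogenization at the unit vectors, up to sign.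
\<close>
lemma l_eq_combination:
  assumes j: "j \<in> {1..m}" and J: "J \<subseteq> {1..m}"
    and q: "\<And>z. homogenization j z = (\<Sum>k\<in>J. q k * homogenization k z)"
  shows "l j = (\<Sum>k\<in>J. pscale (q k) (l k))"
proof -
  have "homogenization k (\<lambda>x. if x = None then 1 else 0) = 1" for k
    by (simp add: homogenization_def)
  then have const: "1 = (\<Sum>k\<in>J. q k)"
    using q[of "\<lambda>x. if x = None then 1 else 0"] by simp
  have "homogenization k (\<lambda>x. if x = Some t then 1 else 0) = - complex_of_real (b k $ t)" for k t
    by (simp add: homogenization_def if_distrib cong: if_cong)
  then have coeff: "complex_of_real (b j $ t) = (\<Sum>k\<in>J. q k * complex_of_real (b k $ t))" for t
    using q[of "\<lambda>x. if x = Some t then 1 else 0"] by (simp add: sum_negf)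
  have Const_sum: "Const (\<Sum>k\<in>J. g k) = (\<Sum>k\<in>J. Const (g k) :: 'd cpoly)" for g
    by (induction J rule: infinite_finite_induct) (simp_all add: Const_add, simp_all add: Const_def)
  have "pscale (q k) (l k) = Const (q k) - (\<Sum>t\<in>UNIV. Const (q k * complex_of_real (b k $ t)) * Var t)"
    if "k \<in> J" for k
  proof -
    have "l k = linear_function (b k)" using that J l_eq by blast
    then show ?thesis
      by (simp add: pscale_def linear_function_def right_diff_distrib sum_distrib_left Const_mult mult.assoc)
  qed
  then have "(\<Sum>k\<in>J. pscale (q k) (l k)) = (\<Sum>k\<in>J. Const (q k)
      - (\<Sum>t\<in>UNIV. Const (q k * complex_of_real (b k $ t)) * Var t))"
    by (rule sum.cong[OF refl])
  also have "\<dots> = Const (\<Sum>k\<in>J. q k)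
      - (\<Sum>k\<in>J. \<Sum>t\<in>UNIV. Const (q k * complex_of_real (b k $ t)) * Var t)"
    unfolding sum_subtractf Const_sum ..
  also have "(\<Sum>k\<in>J. \<Sum>t\<in>UNIV. Const (q k * complex_of_real (b k $ t)) * Var t)
      = (\<Sum>t\<in>UNIV. Const (complex_of_real (b j $ t)) * Var t)"
    by (subst sum.swap) (simp add: coeff Const_sum sum_distrib_right)
  also have "Const (\<Sum>k\<in>J. q k) - (\<Sum>t\<in>UNIV. Const (complex_of_real (b j $ t)) * Var t) = l j"
    using j by (simp add: const[symmetric] Const_1 l_eq linear_function_def)
  finally show ?thesis by simp
qed

lemma chi_independent_imp_nbc_on:
  assumes chi: "chi_independent l m I"
  shows "nbc_on homogenization UNIV {1..m} I"
  unfolding nbc_on_def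
proof (intro ballI notI)
  fix j assume j: "j \<in> {1..m}"
  assume "\<exists>q. \<forall>z\<in>UNIV. homogenization j z = (\<Sum>k\<in>{k \<in> I. k < j}. q k * homogenization k z)"
  then obtain q where "\<And>z. homogenization j z = (\<Sum>k\<in>{k \<in> I. k < j}. q k * homogenization k z)"
    by blast
  then have "l j = (\<Sum>k\<in>{k \<in> I. k < j}. pscale (q k) (l k))"
    using chi j by (intro l_eq_combination) (auto simp: chi_independent_def)
  also have "\<dots> \<in> cpoly.span (l ` {k \<in> I. k < j})"
    by (intro cpoly.span_sum cpoly.span_scale cpoly.span_base) blast
  finally show False using chi_independent_not_in_span[OF chi j] by blast
qed

text \<open>
  All products have \<open>m - s\<close> factors, so where the homogenizing variable is nonzero its
  \<open>(m - s)\<close>-th power can be extracted. Cancelling that variable extends the homogeneous relation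
  to the hyperplane at infinity.
\<close>
lemma chi_independent_products_independent:
  assumes F: "F \<subseteq> {I. chi_independent l m I \<and> card I = s}"
    and zero: "(\<Sum>I\<in>F. Const (c I) * (\<Prod>i\<in>{1..m} - I. l i)) = 0"
    and I: "I \<in> F"
  shows "c I = 0"
proof -
  define c' where "c' I = (if I \<in> F then c I else 0)" for I
  have sub: "F \<subseteq> Pow {1..m}" using F by (auto simp: chi_independent_def)
  define P where "P z = (\<Sum>I\<in>Pow {1..m}. c' I * (\<Prod>i\<in>{1..m} - I. homogenization i z))" for z
  have P_eq: "P z = (\<Sum>I\<in>F. c I * (\<Prod>i\<in>{1..m} - I. homogenization i z))" for z
    unfolding P_def by (rule sum.mono_neutral_cong_right) (use sub in \<open>auto simp: c'_def\<close>)
  have affine: "P z = 0" if z: "z None \<noteq> 0" for z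
  proof -
    define y where "y t = z (Some t) / z None" for t
    have "P z = (\<Sum>I\<in>F. z None ^ (m - s) * (c I * point_eval y (\<Prod>i\<in>{1..m} - I. l i)))"
      unfolding P_eq
    proof (rule sum.cong[OF refl])
      fix I assume I: "I \<in> F"
      have "(\<Prod>i\<in>{1..m} - I. homogenization i z) = (\<Prod>i\<in>{1..m} - I. z None * point_eval y (l i))"
        unfolding y_def by (rule prod.cong[OF refl], rule homogenization_eq_point_eval) (use z in auto)
      also have "\<dots> = z None ^ card ({1..m} - I) * (\<Prod>i\<in>{1..m} - I. point_eval y (l i))"
        by (simp add: prod.distrib)
      also have "card ({1..m} - I) = m - s"
        using I F sub by (subst card_Diff_subset) (auto intro: finite_subset)
      finally show "c I * (\<Prod>i\<in>{1..m} - I. homogenization i z)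
          = z None ^ (m - s) * (c I * point_eval y (\<Prod>i\<in>{1..m} - I. l i))"
        by (simp add: point_eval.subst_prod mult.left_commute)
    qed
    also have "\<dots> = z None ^ (m - s) * point_eval y (\<Sum>I\<in>F. Const (c I) * (\<Prod>i\<in>{1..m} - I. l i))"
      by (simp add: sum_distrib_left point_eval.subst_sum point_eval.subst_mult point_eval.subst_Const)
    finally show ?thesis unfolding zero by (simp add: point_eval.subst_0)
  qed
  have UNIV: "point_subspace (UNIV :: ('d option \<Rightarrow> complex) set)"
    by (simp add: point_subspace_def)
  have None: "linear_form (\<lambda>z :: 'd option \<Rightarrow> complex. z None)"
    by (simp add: linear_form_def)
  have P: "P z = 0" for z
    unfolding P_def
    by (rule cancel_linear_form[OF UNIV None, where w = "\<lambda>_. 1"])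
      (use affine in \<open>auto simp: linear_form_homogenization P_def\<close>)
  have "c' I = 0"
  proof (rule nbc_products_independent[of "{1..m}" UNIV homogenization c' I])
    show "(\<Sum>I\<in>Pow {1..m}. c' I * (\<Prod>i\<in>{1..m} - I. homogenization i z)) = 0" for z
      by (rule P[unfolded P_def])
    show "nbc_on homogenization UNIV {1..m} I" if "c' I \<noteq> 0" for I
      using that F by (intro chi_independent_imp_nbc_on) (auto simp: c'_def split: if_splits)
    show "I \<subseteq> {1..m}" using I sub by blast
  qed (simp_all add: UNIV linear_form_homogenization)
  then show ?thesis using I by (simp add: c'_def)
qed

lemma independent_reciprocals:
  "ratfun.independent {1 / (\<Prod>i\<in>I. Fract (l i) 1) | I. chi_independent l m I \<and> card I = s}"
proof
  define g where "g I = 1 / (\<Prod>i\<in>I. Fract (l i) 1)" for I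
  let ?N = "{I. chi_independent l m I \<and> card I = s}"
  have set_eq: "{1 / (\<Prod>i\<in>I. Fract (l i) 1) | I. chi_independent l m I \<and> card I = s} = g ` ?N"
    by (auto simp: g_def)
  assume "ratfun.dependent {1 / (\<Prod>i\<in>I. Fract (l i) 1) | I. chi_independent l m I \<and> card I = s}"
  then obtain T u v where T: "T \<subseteq> g ` ?N" "(\<Sum>w\<in>T. rscale (u w) w) = 0" "v \<in> T" "u v \<noteq> 0"
    unfolding set_eq ratfun.dependent_explicit by blast
  \<comment> \<open>index the relation by sets, one for each reciprocal that occurs\<close>
  then obtain F where F: "F \<subseteq> ?N" "inj_on g F" "T = g ` F"
    by (auto simp: subset_image_inj)
  define D where "D = (\<Prod>i\<in>{1..m}. Fract (l i) 1)"
  have clear: "D * rscale (u (g I)) (g I) = Fract (Const (u (g I)) * (\<Prod>i\<in>{1..m} - I. l i)) 1"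
    if "I \<in> F" for I
  proof -
    have I: "I \<subseteq> {1..m}" using that F by (auto simp: chi_independent_def)
    have "D = (\<Prod>i\<in>I. Fract (l i) 1) * (\<Prod>i\<in>{1..m} - I. Fract (l i) 1)"
      unfolding D_def by (subst prod.subset_diff[OF I]) (simp_all add: mult.commute)
    moreover have "(\<Prod>i\<in>I. Fract (l i) 1) \<noteq> 0"
      using I l_nonzero
      by (subst prod_zero_iff) (auto simp: Zero_fract_def eq_fract intro: finite_subset)
    ultimately have "D * g I = (\<Prod>i\<in>{1..m} - I. Fract (l i) 1)"
      by (simp add: g_def)
    then have "D * rscale (u (g I)) (g I)
        = Fract (Const (u (g I))) 1 * Fract (\<Prod>i\<in>{1..m} - I. l i) 1"
      unfolding Fract_prod by (simp add: rscale_def mult.left_commute[of D])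
    then show ?thesis by simp
  qed
  have "0 = D * (\<Sum>I\<in>F. rscale (u (g I)) (g I))"
    using T(2) F by (simp add: sum.reindex)
  also have "\<dots> = Fract (\<Sum>I\<in>F. Const (u (g I)) * (\<Prod>i\<in>{1..m} - I. l i)) 1"
    unfolding sum_distrib_left Fract_sum by (rule sum.cong) (simp_all add: clear)
  finally have "(\<Sum>I\<in>F. Const (u (g I)) * (\<Prod>i\<in>{1..m} - I. l i)) = 0"
    by (simp add: Zero_fract_def eq_fract)
  then have "u (g I) = 0" if "I \<in> F" for I
    using chi_independent_products_independent[OF F(1), of "\<lambda>I. u (g I)"] that by blast
  then show False using T F by auto
qed

section \<open>The exchange identity\<close>

text \<open>
  Multiply numerator and denominator by \<open>l i\<close>, replace it in the numerator by the combination of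
  the \<open>l k\<close>, and cancel \<open>l k\<close> in the summand belonging to \<open>k\<close>. Summands with \<open>a k = 0\<close> are zero.
\<close>
lemma exchange_identity:
  assumes "B \<subseteq> {1..m}" and "i \<in> {1..m}" and "i \<notin> B"
    and rel: "(\<Sum>k\<in>insert i B. pscale (a k) (l k)) = 0" and "a i \<noteq> 0"
    and D: "B \<subseteq> set_mset D" "set_mset D \<subseteq> {1..m}"
  shows "Fract G (denom l D)
    = (\<Sum>k\<in>B. Fract (pscale (- a k / a i) G) (denom l (add_mset i D - {#k#})))"
proof -
  have nz: "denom l D' \<noteq> 0" if "set_mset D' \<subseteq> {1..m}" for D'
    using that l_nonzero by (auto simp: denom_def prod_mset_zero_iff)
  have "finite B" using assms by (auto intro: finite_subset)
  have "pscale (a i) (l i) = - (\<Sum>k\<in>B. pscale (a k) (l k))"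
    using rel \<open>i \<notin> B\<close> \<open>finite B\<close> by (simp add: eq_neg_iff_add_eq_0)
  then have "pscale (1 / a i) (pscale (a i) (l i)) = (\<Sum>k\<in>B. pscale (- a k / a i) (l k))"
    by (simp add: cpoly.scale_sum_right flip: sum_negf cpoly.scale_minus_left)
  then have li: "l i = (\<Sum>k\<in>B. pscale (- a k / a i) (l k))"
    using \<open>a i \<noteq> 0\<close> by simp
  have "Fract G (denom l D) = Fract (G * l i) (denom l (add_mset i D))"
    using nz[OF D(2)] l_nonzero[OF \<open>i \<in> {1..m}\<close>] by (simp add: eq_fract denom_def mult_ac)
  also have "\<dots> = (\<Sum>k\<in>B. Fract (G * pscale (- a k / a i) (l k)) (denom l (add_mset i D)))"
    by (subst li) (simp add: sum_distrib_left Fract_sum)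
  also have "\<dots> = (\<Sum>k\<in>B. Fract (pscale (- a k / a i) G) (denom l (add_mset i D - {#k#})))"
  proof (rule sum.cong[OF refl])
    fix k assume "k \<in> B"
    then have k: "k \<in># add_mset i D" using D by auto
    have "denom l (add_mset i D) = l k * denom l (add_mset i D - {#k#})"
      by (subst insert_DiffM[OF k, symmetric]) (simp add: denom_def)
    moreover have "denom l (add_mset i D) \<noteq> 0"
      using D \<open>i \<in> {1..m}\<close> by (intro nz) auto
    ultimately show "Fract (G * pscale (- a k / a i) (l k)) (denom l (add_mset i D))
        = Fract (pscale (- a k / a i) G) (denom l (add_mset i D - {#k#}))"
      by (simp add: eq_fract pscale_def mult_ac)
  qed
  finally show ?thesis .
qed

text \<open>
  Exchanges raise the sum of the indices and keep the size of the multiset; subtracting from \<open>m\<close>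
  makes this a decreasing quantity.
\<close>
definition exchange_weight :: "nat multiset \<Rightarrow> nat"
  where "exchange_weight D = (\<Sum>j\<in>#D. m - j)"

lemma exchange_weight_less:
  assumes "k \<in># D" and "k < i" and "i \<le> m"
  shows "exchange_weight (add_mset i D - {#k#}) < exchange_weight D"
proof -
  obtain D' where D: "D = add_mset k D'" using assms(1) by (metis mset_add)
  have "add_mset i D - {#k#} = add_mset i D'"
    by (simp add: D add_mset_commute)
  then show ?thesis using assms D by (simp add: exchange_weight_def)
qed

lemma broken_circuit_relation:
  assumes "broken_circuit l m B"
  obtains i a where "i \<in> {1..m}" and "\<forall>k\<in>B. k < i"
    and "(\<Sum>k\<in>insert i B. pscale (a k) (l k)) = 0" and "a i \<noteq> 0"
proof -
  obtain i where i: "i \<in> {1..m}" "\<forall>k\<in>B. k < i" "B \<subseteq> {1..m}" "l i \<in> cpoly.span (l ` B)"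
    using broken_circuit_completion[OF assms] by blast
  then obtain q where q: "l i = (\<Sum>k\<in>B. pscale (q k) (l k))"
    using span_l_combination by blast
  have "i \<notin> B" "finite B" using i by (auto intro: finite_subset)
  moreover have "(\<Sum>k\<in>B. pscale ((q(i := - 1)) k) (l k)) = l i"
    unfolding q by (rule sum.cong) (use \<open>i \<notin> B\<close> in auto)
  ultimately have "(\<Sum>k\<in>insert i B. pscale ((q(i := - 1)) k) (l k)) = 0"
    by simp
  then show thesis using that[of i "q(i := -1)"] i by simp
qed

lemma reciprocal_in_span:
  assumes "set_mset A \<subseteq> {1..m}" and "size A = M"
  shows "1 / (\<Prod>j\<in>#A. Fract (l j) 1) \<in>
    ratfun.span {1 / (\<Prod>i\<in>I. Fract (l i) 1 ^ p i) | I p.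
      chi_independent l m I \<and> (\<forall>i\<in>I. p i \<ge> 1) \<and> (\<Sum>i\<in>I. p i) = M}"
    (is "_ \<in> ratfun.span ?S")
proof -
  have recip: "1 / (\<Prod>j\<in>#A. Fract (l j) 1) = Fract 1 (denom l A)" for A
  proof -
    have "(\<Prod>j\<in>#A. Fract (l j) 1) = Fract (denom l A) 1"
      by (induction A) (simp_all add: denom_def One_fract_def)
    then show ?thesis by (simp add: One_fract_def)
  qed
  have "Fract 1 (denom l A) \<in> ratfun.span ?S"
    using assms
  proof (induction "exchange_weight A" arbitrary: A rule: less_induct)
    case less
    show ?case
    proof (cases "chi_independent l m (set_mset A)")
      case True
      have "(\<Prod>j\<in>#A. Fract (l j) 1) = (\<Prod>i\<in>set_mset A. Fract (l i) 1 ^ count A i)"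
        by (rule image_prod_mset_multiplicity)
      moreover have "(\<Sum>i\<in>set_mset A. count A i) = M"
        using less.prems by (simp add: size_multiset_overloaded_eq)
      ultimately have "1 / (\<Prod>j\<in>#A. Fract (l j) 1) \<in> ?S"
        using True by (auto intro!: exI[of _ "set_mset A"] exI[of _ "count A"] simp: Suc_le_eq)
      then show ?thesis unfolding recip by (rule ratfun.span_base)
    next
      case False
      then obtain B where B: "broken_circuit l m B" "B \<subseteq> set_mset A"
        using less.prems by (auto simp: chi_independent_def)
      obtain i a where i: "i \<in> {1..m}" "\<forall>k\<in>B. k < i"
        and rel: "(\<Sum>k\<in>insert i B. pscale (a k) (l k)) = 0" "a i \<noteq> 0"
        using broken_circuit_relation[OF B(1)] .
      have "Fract 1 (denom l A)
          = (\<Sum>k\<in>B. Fract (pscale (- a k / a i) 1) (denom l (add_mset i A - {#k#})))"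
        using i B rel less.prems by (intro exchange_identity) auto
      also have "\<dots> = (\<Sum>k\<in>B. rscale (- a k / a i) (Fract 1 (denom l (add_mset i A - {#k#}))))"
        by (simp add: rscale_def pscale_def)
      also have "\<dots> \<in> ratfun.span ?S"
      proof (intro ratfun.span_sum ratfun.span_scale less.hyps)
        fix k assume k: "k \<in> B"
        then show "exchange_weight (add_mset i A - {#k#}) < exchange_weight A"
          using i B by (intro exchange_weight_less) auto
        show "set_mset (add_mset i A - {#k#}) \<subseteq> {1..m}"
          using less.prems(1) i set_mset_mono[OF diff_subset_eq_self[of "add_mset i A" "{#k#}"]]
          by auto
        have "k \<in># add_mset i A" using k B by auto
        then show "size (add_mset i A - {#k#}) = M"
          using less.prems(2) by (simp add: size_Diff_singleton)
      qed
      finally show ?thesis .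
    qed
  qed
  then show ?thesis by (simp add: recip)
qed

section \<open>Supports and lowest terms\<close>

lemma denom_nonzero: "set_mset D \<subseteq> {1..m} \<Longrightarrow> denom l D \<noteq> 0"
  using l_nonzero by (auto simp: denom_def prod_mset_zero_iff)

lemma l_dvd_denom:
  assumes j: "j \<in> {1..m}" and D: "set_mset D \<subseteq> {1..m}" and dvd: "l j dvd denom l D"
  shows "j \<in># D"
  using D dvd
proof (induction D)
  case empty
  then show ?case using prime_elem_l[OF j] by (simp add: denom_def prime_elem_def)
next
  case (add k D)
  then have "l j dvd l k \<or> l j dvd denom l D"
    using prime_elem_l[OF j] by (auto simp: denom_def dest: prime_elem_dvd_multD)
  then show ?case using add j l_dvd_l_imp_eq[of j k] by auto
qed

lemma chi_independent_mono: "chi_independent l m I \<Longrightarrow> J \<subseteq> I \<Longrightarrow> chi_independent l m J"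
  unfolding chi_independent_def by blast

lemma denom_dvd: "j \<in># D \<Longrightarrow> denom l D = l j * denom l (D - {#j#})"
  by (metis denom_def image_mset_add_mset insert_DiffM prod_mset.add_mset)

text \<open>
  If \<open>G / D = G' / D'\<close> and \<open>l j\<close> divides \<open>D'\<close> but not \<open>G'\<close>, then by primality \<open>l j\<close> divides \<open>D\<close>, and by
  non-associatedness it is one of the factors of \<open>D\<close>.
\<close>
lemma support_subset:
  assumes D: "set_mset D \<subseteq> {1..m}"
  shows "support l m (frac_val l (G, D)) \<subseteq> set_mset D"
proof
  fix j assume "j \<in> support l m (frac_val l (G, D))"
  then obtain G' D' where D': "set_mset D' \<subseteq> {1..m}" and j: "j \<in># D'"
    and low: "\<not> l j dvd G'" and eq: "Fract G (denom l D) = Fract G' (denom l D')"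
    by (auto simp: support_def)
  have "G * denom l D' = G' * denom l D"
    using eq denom_nonzero[OF D] denom_nonzero[OF D'] by (simp add: eq_fract)
  then have "l j dvd G' * denom l D"
    using denom_dvd[OF j] by (metis dvd_mult dvd_triv_left)
  moreover have jm: "j \<in> {1..m}" using j D' by auto
  ultimately have "l j dvd denom l D"
    using low prime_elem_dvd_multD[OF prime_elem_l[OF jm]] by blast
  then show "j \<in># D" by (rule l_dvd_denom[OF jm D])
qed

text \<open>
  A nonzero scalar can be moved to the numerator in lowest terms. For \<open>c = 0\<close> the numerator in
  lowest terms is \<open>0\<close>, which every \<open>l j\<close> divides, so that the denominator is trivial.
\<close>
lemma lowest_terms_scaled_support:
  assumes D': "set_mset D' \<subseteq> {1..m}" and low: "lowest_terms l (G', D')"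
    and eq: "frac_val l (G', D') = frac_val l (pscale c G, D)" and D: "set_mset D \<subseteq> {1..m}"
  shows "set_mset D' \<subseteq> support l m (frac_val l (G, D))"
proof (cases "c = 0")
  case True
  then have "G' = 0"
    using eq denom_nonzero[OF D] denom_nonzero[OF D'] by (simp add: eq_fract)
  then have "D' = {#}" using low by (auto intro: multiset_nonemptyE)
  then show ?thesis by simp
next
  case False
  define H where "H = pscale (1 / c) G'"
  have G': "G' = pscale c H" using False by (simp add: H_def)
  then have "lowest_terms l (H, D')" using low by (auto simp: pscale_def)
  moreover have "pscale c (G * denom l D') = pscale c (H * denom l D)"
    using eq denom_nonzero[OF D] denom_nonzero[OF D'] by (auto simp: eq_fract G' pscale_def mult.assoc)
  then have "G * denom l D' = H * denom l D"
    using False by (simp add: cpoly.scale_cancel_left)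
  then have "frac_val l (G, D) = frac_val l (H, D')"
    using denom_nonzero[OF D] denom_nonzero[OF D'] by (simp add: eq_fract)
  ultimately show ?thesis using D' unfolding support_def by blast
qed

lemma lowest_terms_exist:
  assumes "set_mset D \<subseteq> {1..m}"
  shows "\<exists>G' D'. lowest_terms l (G', D') \<and> D' \<subseteq># D \<and> frac_val l (G', D') = frac_val l (G, D)"
  using assms
proof (induction "size D" arbitrary: G D)
  case 0
  then have "lowest_terms l (G, D)" by simp
  then show ?case by blast
next
  case (Suc n)
  show ?case
  proof (cases "lowest_terms l (G, D)")
    case False
    then obtain j H where j: "j \<in># D" and H: "G = l j * H" by (auto simp: dvd_def)
    have sub: "D - {#j#} \<subseteq># D" by simp
    have "frac_val l (H, D - {#j#}) = frac_val l (G, D)"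
      using denom_nonzero[OF Suc.prems] unfolding frac_val.simps H denom_dvd[OF j]
      by (simp add: mult_fract_cancel)
    moreover have "n = size (D - {#j#})" "set_mset (D - {#j#}) \<subseteq> {1..m}"
      using Suc.hyps(2) Suc.prems j set_mset_mono[OF sub] by (auto simp: size_Diff_singleton)
    ultimately show ?thesis
      using Suc.hyps(1)[of "D - {#j#}" H] sub by (metis subset_mset.order_trans)
  qed blast
qed

section \<open>Invariants of SimpleDecomp\<close>

abbreviation supported :: "'d fraction multiset \<Rightarrow> bool"
  where "supported S \<equiv> \<forall>(G, D)\<in>#S. set_mset D \<subseteq> {1..m}"

definition total :: "'d fraction multiset \<Rightarrow> 'd ratfun"
  where "total S = (\<Sum>F\<in>#S. frac_val l F)"

lemma total_simps [simp]:
  "total {#} = 0" "total (add_mset F S) = frac_val l F + total S" "total (S + T) = total S + total T"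
  by (simp_all add: total_def)

lemma total_mset_set: "total (image_mset f (mset_set K)) = (\<Sum>k\<in>K. frac_val l (f k))"
  by (simp add: total_def sum_unfold_sum_mset image_mset.compositionality comp_def)

text \<open>
  The numerators stay nonzero multiples of \<open>G0\<close> because the summands with vanishing coefficient are
  left out.
\<close>
lemma exchange_invariant:
  assumes "exchange l m S S'" and "supported S"
    and "\<forall>(G, D)\<in>#S. \<exists>c. c \<noteq> 0 \<and> G = pscale c G0"
  shows "supported S'" and "total S' = total S"
    and "\<forall>(G, D)\<in>#S'. \<exists>c. c \<noteq> 0 \<and> G = pscale c G0"
    and "(image_mset (exchange_weight \<circ> snd) S', image_mset (exchange_weight \<circ> snd) S) \<in> mult less_than"
proof -
  obtain B G D i a T where S: "S = add_mset (G, D) T"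
    and S': "S' = image_mset (\<lambda>k. (pscale (- a k / a i) G, add_mset i D - {#k#}))
        (mset_set {k \<in> B. a k \<noteq> 0}) + T"
    and B: "broken_circuit l m B" "B \<subseteq> support l m (frac_val l (G, D))"
    and i: "i \<in> {1..m}" "\<forall>k\<in>B. k < i"
    and rel: "(\<Sum>k\<in>insert i B. pscale (a k) (l k)) = 0" "a i \<noteq> 0"
    using assms(1) by (auto elim!: exchange.cases)
  have D: "set_mset D \<subseteq> {1..m}" using assms(2) S by auto
  have BD: "B \<subseteq> set_mset D" using B support_subset[OF D] by blast
  then have fin: "finite B" by (rule finite_subset) simp
  have "set_mset (add_mset i D - {#k#}) \<subseteq> {1..m}" for k
    using D i set_mset_mono[OF diff_subset_eq_self[of "add_mset i D" "{#k#}"]] by auto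
  then show "supported S'" using assms(2) S S' by auto
  have "frac_val l (G, D)
      = (\<Sum>k\<in>B. frac_val l (pscale (- a k / a i) G, add_mset i D - {#k#}))"
    unfolding frac_val.simps using B BD D i rel by (intro exchange_identity) auto
  also have "\<dots> = (\<Sum>k\<in>{k \<in> B. a k \<noteq> 0}. frac_val l (pscale (- a k / a i) G, add_mset i D - {#k#}))"
    by (rule sum.mono_neutral_right) (use fin in \<open>auto simp: fract_collapse\<close>)
  finally show "total S' = total S"
    unfolding S S' by (simp only: total_simps total_mset_set)
  obtain c where c: "c \<noteq> 0" "G = pscale c G0" using assms(3) S by auto
  have "\<exists>c'. c' \<noteq> 0 \<and> pscale (- a k / a i) G = pscale c' G0" if "a k \<noteq> 0" for k
    using c that rel(2) by (intro exI[of _ "- a k / a i * c"]) simp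
  then show "\<forall>(G, D)\<in>#S'. \<exists>c. c \<noteq> 0 \<and> G = pscale c G0"
    using assms(3) S S' fin by auto
  have "exchange_weight (add_mset i D - {#k#}) < exchange_weight D" if "k \<in> B" for k
    using that BD i by (intro exchange_weight_less) auto
  then have "(image_mset (exchange_weight \<circ> snd) T
        + image_mset (\<lambda>k. exchange_weight (add_mset i D - {#k#})) (mset_set {k \<in> B. a k \<noteq> 0}),
      image_mset (exchange_weight \<circ> snd) T + {#exchange_weight D#}) \<in> mult less_than"
    using fin by (intro one_step_implies_mult) auto
  then show "(image_mset (exchange_weight \<circ> snd) S', image_mset (exchange_weight \<circ> snd) S) \<in> mult less_than"
    by (simp add: S S' image_mset.compositionality comp_def add.commute)
qed

text \<open>
  The condition that holds from the end of the exchanges on. The second alternative speaks about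
  the support of \<open>G0 / D\<close> and not of \<open>G / D\<close>, so that it only depends on \<open>D\<close> and survives when
  numerators are added up. With arbitrary numerators it could fail: for \<open>D = {#1, 2#}\<close> the
  numerators \<open>l\<^sub>1\<close> and \<open>l\<^sub>2\<close> give singletons as supports, but their sum gives \<open>{1, 2}\<close>.
\<close>
fun collected :: "'d cpoly \<Rightarrow> 'd fraction \<Rightarrow> bool"
  where "collected G0 (G, D) \<longleftrightarrow> chi_independent l m (set_mset D) \<or>
    (\<exists>c. G = pscale c G0) \<and> no_broken_circuit_in_support l m (G0, D)"

lemma lowest_terms_collected:
  assumes "set_mset D' \<subseteq> {1..m}" and "lowest_terms l (G', D')" and "D' \<subseteq># D"
    and "frac_val l (G', D') = frac_val l (G, D)" and "set_mset D \<subseteq> {1..m}"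
    and "collected G0 (G, D)"
  shows "chi_independent l m (set_mset D')"
proof (cases "chi_independent l m (set_mset D)")
  case True
  then show ?thesis by (rule chi_independent_mono[OF _ set_mset_mono[OF assms(3)]])
next
  case False
  then obtain c where "G = pscale c G0" and no: "no_broken_circuit_in_support l m (G0, D)"
    using assms(6) by auto
  then have "set_mset D' \<subseteq> support l m (frac_val l (G0, D))"
    using assms by (intro lowest_terms_scaled_support[where c = c]) auto
  then show ?thesis
    using no assms(1) unfolding no_broken_circuit_in_support_def chi_independent_def by blast
qed

text \<open>
  Only \<open>simplify\<close> changes a denominator, and its result is chi-independent by the previous lemma.
\<close>
lemma collect_invariant:
  assumes "collect l S S'" and "supported S"
    and "\<forall>F\<in>#S. collected G0 F"
  shows "supported S'" and "total S' = total S"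
    and "\<forall>F\<in>#S'. collected G0 F"
    and "(image_mset (size \<circ> snd) S', image_mset (size \<circ> snd) S) \<in> mult less_than"
proof -
  have "supported S' \<and> total S' = total S \<and> (\<forall>F\<in>#S'. collected G0 F)
      \<and> (image_mset (size \<circ> snd) S', image_mset (size \<circ> snd) S) \<in> mult less_than"
    using assms
  proof (cases rule: collect.cases)
    case (combine G D H T)
    have "denom l D \<noteq> 0" using assms(2) combine by (intro denom_nonzero) auto
    then have "frac_val l (G + H, D) = frac_val l (G, D) + frac_val l (H, D)"
      by (simp add: eq_fract algebra_simps)
    moreover have "collected G0 (G + H, D)"
      using assms(3) combine(1) by (auto simp: cpoly.scale_left_distrib[symmetric])
    moreover have "({#size D#} + image_mset (size \<circ> snd) T + {#},
        {#size D#} + image_mset (size \<circ> snd) T + {#size D#}) \<in> mult less_than"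
      by (intro one_step_implies_mult) auto
    ultimately show ?thesis
      using assms(2,3) unfolding combine by (auto simp: add.assoc add_mset_commute)
  next
    case (simplify G D G' D' T)
    have D: "set_mset D \<subseteq> {1..m}" "collected G0 (G, D)" using assms(2,3) simplify by auto
    then have D': "set_mset D' \<subseteq> {1..m}" using set_mset_mono[OF simplify(5)] by blast
    have "D' \<noteq> D"
    proof
      assume "D' = D"
      then have "G' = G"
        using simplify(6) denom_nonzero[OF D(1)] by (simp add: eq_fract)
      then show False using simplify \<open>D' = D\<close> by simp
    qed
    then have "size D' < size D"
      using simplify(5) by (intro mset_subset_size) (simp add: subset_mset.less_le)
    then have "(image_mset (size \<circ> snd) T + {#size D'#},
        image_mset (size \<circ> snd) T + {#size D#}) \<in> mult less_than"
      by (intro one_step_implies_mult) auto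
    moreover have "chi_independent l m (set_mset D')"
      using D D' simplify by (intro lowest_terms_collected[of D' G' D G G0]) auto
    ultimately show ?thesis
      using assms(2,3) D' simplify(6) unfolding simplify(1,2) by auto
  next
    case (discard D)
    have "(image_mset (size \<circ> snd) S' + {#},
        image_mset (size \<circ> snd) S' + {#size D#}) \<in> mult less_than"
      by (intro one_step_implies_mult) auto
    then show ?thesis using assms(2,3) unfolding discard by (auto simp: fract_collapse)
  qed
  then show "supported S'" and "total S' = total S"
    and "\<forall>F\<in>#S'. collected G0 F"
    and "(image_mset (size \<circ> snd) S', image_mset (size \<circ> snd) S) \<in> mult less_than"
    by blast+
qed

lemma expand_invariant:
  assumes "expand l S S'" and "\<forall>(G, D)\<in>#S. chi_independent l m (set_mset D)"
  shows "total S' = total S" and "\<forall>(G, D)\<in>#S'. chi_independent l m (set_mset D)"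
    and "(image_mset (size \<circ> snd) S', image_mset (size \<circ> snd) S) \<in> mult less_than"
proof -
  obtain G D T h where S: "S = add_mset (G, D) T"
    and S': "S' = image_mset (\<lambda>j. (h j, D - {#j#})) (mset_set (set_mset D)) + T"
    and G: "G = (\<Sum>j\<in>set_mset D. h j * l j)"
    using assms(1) by (auto elim!: expand.cases)
  have chi: "chi_independent l m (set_mset D)" using assms(2) S by auto
  then have nz: "denom l D \<noteq> 0" by (intro denom_nonzero) (simp add: chi_independent_def)
  have "frac_val l (G, D) = (\<Sum>j\<in>set_mset D. frac_val l (h j, D - {#j#}))"
    unfolding frac_val.simps G Fract_sum
  proof (rule sum.cong[OF refl])
    fix j assume "j \<in># D"
    show "Fract (h j * l j) (denom l D) = Fract (h j) (denom l (D - {#j#}))"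
      using nz unfolding denom_dvd[OF \<open>j \<in># D\<close>] by (simp add: mult_fract_cancel mult.commute[of "h j"])
  qed
  then show "total S' = total S"
    unfolding S S' by (simp only: total_simps total_mset_set)
  have "chi_independent l m (set_mset (D - {#j#}))" for j
    by (rule chi_independent_mono[OF chi set_mset_mono[OF diff_subset_eq_self]])
  then show "\<forall>(G, D)\<in>#S'. chi_independent l m (set_mset D)"
    using assms(2) S S' by auto
  have "(image_mset (size \<circ> snd) T + image_mset (\<lambda>j. size (D - {#j#})) (mset_set (set_mset D)),
      image_mset (size \<circ> snd) T + {#size D#}) \<in> mult less_than"
    by (intro one_step_implies_mult) (auto simp: size_Diff1_less)
  then show "(image_mset (size \<circ> snd) S', image_mset (size \<circ> snd) S) \<in> mult less_than"
    by (simp add: S S' image_mset.compositionality comp_def add.commute)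
qed

fun invariant :: "'d cpoly \<Rightarrow> 'd ratfun \<Rightarrow> phase \<times> 'd fraction multiset \<Rightarrow> bool"
  where "invariant G0 f (ph, S) \<longleftrightarrow> supported S \<and> total S = f \<and>
    (case ph of Exchanging \<Rightarrow> \<forall>(G, D)\<in>#S. \<exists>c. c \<noteq> 0 \<and> G = pscale c G0
      | Collecting \<Rightarrow> \<forall>F\<in>#S. collected G0 F
      | _ \<Rightarrow> \<forall>(G, D)\<in>#S. chi_independent l m (set_mset D))"

text \<open>
  The first component records that the exchanging phase is never entered again. The last one makes
  the changes of phase that leave the fractions alone count as progress; the return from
  expanding to collecting is paid for by the multiset of degrees.
\<close>
fun state_measure :: "phase \<times> 'd fraction multiset \<Rightarrow> nat \<times> nat multiset \<times> nat"
  where "state_measure (Exchanging, S) = (1, image_mset (exchange_weight \<circ> snd) S, 0)"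
  | "state_measure (Collecting, S) = (0, image_mset (size \<circ> snd) S, 2)"
  | "state_measure (Expanding, S) = (0, image_mset (size \<circ> snd) S, 1)"
  | "state_measure (Finished, S) = (0, image_mset (size \<circ> snd) S, 0)"

abbreviation measure_order :: "((nat \<times> nat multiset \<times> nat) \<times> (nat \<times> nat multiset \<times> nat)) set"
  where "measure_order \<equiv> less_than <*lex*> mult less_than <*lex*> less_than"

text \<open>
  When no simplification applies, every fraction is in lowest terms.
\<close>
lemma no_collect_chi_independent:
  assumes "\<nexists>S'. collect l S S'" and "supported S" and "\<forall>F\<in>#S. collected G0 F"
    and GD: "(G, D) \<in># S"
  shows "chi_independent l m (set_mset D)"
proof -
  have D: "set_mset D \<subseteq> {1..m}" using assms(2) GD by auto
  obtain T where T: "S = add_mset (G, D) T" using GD by (metis mset_add)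
  have low: "lowest_terms l (G, D)"
  proof (rule ccontr)
    assume "\<not> lowest_terms l (G, D)"
    moreover obtain G' D' where "lowest_terms l (G', D')" "D' \<subseteq># D"
      "frac_val l (G', D') = frac_val l (G, D)"
      using lowest_terms_exist[OF D] by blast
    ultimately have "collect l S (add_mset (G', D') T)"
      unfolding T by (intro collect.simplify)
    then show False using assms(1) by blast
  qed
  show ?thesis
    by (rule lowest_terms_collected[OF D low _ refl D]) (use assms(3) GD in auto)
qed

text \<open>
  Only the end of the exchanging phase and the end of a collecting phase require an argument beyond
  the invariants of the single steps. At the former, a numerator \<open>c * G0\<close> with \<open>c \<noteq> 0\<close> has to be
  traded for \<open>G0\<close>.
\<close>
lemma step_invariant:
  assumes "simple_decomp_step l m st st'" and "invariant G0 f st"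
  shows "invariant G0 f st' \<and> (state_measure st', state_measure st) \<in> measure_order"
  using assms
proof (cases rule: simple_decomp_step.cases)
  case (1 S S')
  then show ?thesis using assms(2) exchange_invariant[of S S' G0] by auto
next
  case (2 S)
  have all: "\<forall>(G, D)\<in>#S. \<exists>c. c \<noteq> 0 \<and> G = pscale c G0" using assms(2) 2 by simp
  have "collected G0 F" if FS: "F \<in># S" for F
  proof -
    obtain G D where F: "F = (G, D)" by (cases F)
    then obtain c where c: "c \<noteq> 0" "G = pscale c G0"
      using bspec[OF all FS] by auto
    have D: "set_mset D \<subseteq> {1..m}" using that assms(2) F unfolding 2 by auto
    have "support l m (frac_val l (G0, D)) \<subseteq> support l m (frac_val l (G, D))"
    proof
      fix j assume "j \<in> support l m (frac_val l (G0, D))"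
      then obtain G' D' where D': "set_mset D' \<subseteq> {1..m}" "lowest_terms l (G', D')"
        "frac_val l (G0, D) = frac_val l (G', D')" "j \<in># D'" by (auto simp: support_def)
      have "G0 = pscale (1 / c) G" unfolding c(2) using c(1) by simp
      then have "set_mset D' \<subseteq> support l m (frac_val l (G, D))"
        using D D' by (intro lowest_terms_scaled_support[where c = "1 / c"]) auto
      then show "j \<in> support l m (frac_val l (G, D))" using D' by blast
    qed
    then have "no_broken_circuit_in_support l m (G0, D)"
      using 2 that F unfolding no_broken_circuit_in_support_def by blast
    then show ?thesis using c F by auto
  qed
  then show ?thesis using assms(2) 2 by simp
next
  case (3 S S')
  then show ?thesis using assms(2) collect_invariant[of S S' G0] by auto
next
  case (4 S)
  then show ?thesis using assms(2) no_collect_chi_independent[of S G0] by auto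
next
  case (5 S S')
  have chi: "\<forall>(G, D)\<in>#S. chi_independent l m (set_mset D)" using assms(2) 5 by simp
  note inv = expand_invariant[OF 5(3) chi]
  have "collected G0 F" if "F \<in># S'" for F
    using inv(2) that by (cases F) auto
  moreover have "supported S'" using inv(2) by (auto simp: chi_independent_def)
  ultimately show ?thesis using inv 5 assms(2) by auto
next
  case (6 S)
  then show ?thesis using assms(2) by auto
qed

lemma reachable_invariant:
  assumes "(simple_decomp_step l m)\<^sup>*\<^sup>* st st'" and "invariant G0 f st"
  shows "invariant G0 f st'"
  using assms by induction (use step_invariant in blast)+

section \<open>Termination and correctness of SimpleDecomp\<close>

text \<open>
  Every phase can be continued: a broken circuit in a support comes with a relation to exchange by,
  and among the finitely many reducible fractions there is one of maximal degree.
\<close>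
lemma progress:
  assumes stuck: "\<nexists>st'. simple_decomp_step l m (ph, S) st'" and inv: "invariant G0 f (ph, S)"
  shows "ph = Finished"
proof (cases ph)
  case Exchanging
  then have "\<not> (\<forall>F\<in>#S. no_broken_circuit_in_support l m F)"
    using stuck simple_decomp_step.intros(2) by blast
  then obtain G D B where GD: "(G, D) \<in># S" and B: "broken_circuit l m B"
    "B \<subseteq> support l m (frac_val l (G, D))"
    by (auto simp: no_broken_circuit_in_support_def)
  obtain T where T: "S = add_mset (G, D) T" using GD by (metis mset_add)
  obtain i a where "i \<in> {1..m}" "\<forall>k\<in>B. k < i"
    "(\<Sum>k\<in>insert i B. pscale (a k) (l k)) = 0" "a i \<noteq> 0"
    using broken_circuit_relation[OF B(1)] .
  then have "exchange l m S (image_mset (\<lambda>k. (pscale (- a k / a i) G, add_mset i D - {#k#}))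
      (mset_set {k \<in> B. a k \<noteq> 0}) + T)"
    unfolding T using B by (intro exchange.intros)
  then show ?thesis using stuck Exchanging simple_decomp_step.intros(1) by blast
next
  case Collecting
  then show ?thesis using stuck simple_decomp_step.intros(3,4) by blast
next
  case Expanding
  then obtain F where "F \<in># S" "reducible l F"
    using stuck simple_decomp_step.intros(6) by blast
  define R where "R = {F \<in> set_mset S. reducible l F}"
  have "F \<in> R"
    using \<open>F \<in># S\<close> \<open>reducible l F\<close> by (simp add: R_def)
  have R: "finite ((size \<circ> snd) ` R)" "(size \<circ> snd) ` R \<noteq> {}"
    using \<open>F \<in> R\<close> by (simp add: R_def, blast)
  obtain G D where GD: "(G, D) \<in> R" "size D = Max ((size \<circ> snd) ` R)"
    using Max_in[OF R] by force
  obtain T where T: "S = add_mset (G, D) T" using GD by (metis (no_types, lifting) R_def mem_Collect_eq mset_add)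
  have max: "\<forall>(G', D')\<in>#T. reducible l (G', D') \<longrightarrow> size D' \<le> size D"
  proof (intro ballI, clarify)
    fix G' D' assume "(G', D') \<in># T" "reducible l (G', D')"
    then have "(G', D') \<in> R" by (simp add: R_def T)
    then show "size D' \<le> size D" unfolding GD(2) using R(1) by (intro Max_ge) force+
  qed
  have D: "set_mset D \<subseteq> {1..m}" using inv T by auto
  have "reducible l (G, D)" using GD by (simp add: R_def)
  then obtain u where "G = (\<Sum>v\<in>l ` set_mset D. u v * v)"
    by (auto simp: ideal.span_finite)
  then have "G = (\<Sum>j\<in>set_mset D. (u \<circ> l) j * l j)"
    using inj_on_subset[OF inj_l D] by (simp add: sum.reindex)
  then have "expand l S (image_mset (\<lambda>j. ((u \<circ> l) j, D - {#j#})) (mset_set (set_mset D)) + T)"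
    unfolding T using \<open>reducible l (G, D)\<close> max by (intro expand.intros)
  then show ?thesis using stuck Expanding simple_decomp_step.intros(5) by blast
qed

context
  fixes G :: "'d cpoly" and p :: "nat \<Rightarrow> nat"
begin

lemma start_invariant:
  "invariant G (Fract G (\<Prod>j\<in>{1..m}. l j ^ p j)) (simple_decomp_start m G p)"
proof -
  have set_D: "set_mset (\<Sum>j\<in>K. replicate_mset (p j) j) \<subseteq> K" if "finite K" for K
    using that by induction (auto split: if_splits)
  have denom_D: "denom l (\<Sum>j\<in>K. replicate_mset (p j) j) = (\<Prod>j\<in>K. l j ^ p j)" if "finite K" for K
    using that by induction (simp_all add: denom_def)
  have "G = pscale 1 G" by simp
  then show ?thesis
    using set_D[of "{1..m}"] denom_D[of "{1..m}"] zero_neq_one[symmetric]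
    unfolding simple_decomp_start_def by (auto intro: exI[of _ 1])
qed

lemma simple_decomp_terminates: "simple_decomp_terminates l m G p"
  unfolding simple_decomp_terminates_def
proof (intro conjI notI allI impI)
  assume "\<exists>run. run 0 = simple_decomp_start m G p \<and>
    (\<forall>n::nat. simple_decomp_step l m (run n) (run (Suc n)))"
  then obtain run where run: "run 0 = simple_decomp_start m G p"
    "\<And>n::nat. simple_decomp_step l m (run n) (run (Suc n))" by blast
  have "invariant G (Fract G (\<Prod>j\<in>{1..m}. l j ^ p j)) (run n)" for n
    by (induction n) (use run start_invariant step_invariant in metis)+
  then have "(state_measure (run (Suc n)), state_measure (run n)) \<in> measure_order" for n
    using step_invariant run(2) by blast
  moreover have "wf measure_order"
    by (intro wf_lex_prod wf_mult wf_less_than)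
  ultimately show False
    unfolding wf_iff_no_infinite_down_chain by (auto dest!: spec[of _ "state_measure \<circ> run"])
next
  fix st
  assume st: "(simple_decomp_step l m)\<^sup>*\<^sup>* (simple_decomp_start m G p) st \<and>
    (\<nexists>st'. simple_decomp_step l m st st')"
  then have "invariant G (Fract G (\<Prod>j\<in>{1..m}. l j ^ p j)) st"
    by (intro reachable_invariant[OF _ start_invariant]) simp
  then show "fst st = Finished"
    using st progress by (cases st) auto
qed

lemma simple_decomp_output_correct:
  assumes "simple_decomp_output l m G p S"
  shows "(\<Sum>F\<in>#S. frac_val l F) = Fract G (\<Prod>j\<in>{1..m}. l j ^ p j)"
    and "\<forall>F\<in>#S. no_broken_circuit_in_support l m F"
proof -
  have inv: "invariant G (Fract G (\<Prod>j\<in>{1..m}. l j ^ p j)) (Finished, S)"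
    by (rule reachable_invariant[OF _ start_invariant])
      (use assms in \<open>simp add: simple_decomp_output_def\<close>)
  then show "(\<Sum>F\<in>#S. frac_val l F) = Fract G (\<Prod>j\<in>{1..m}. l j ^ p j)"
    by (simp add: total_def)
  show "\<forall>F\<in>#S. no_broken_circuit_in_support l m F"
  proof
    fix F assume F: "F \<in># S"
    obtain G' D where GD: "F = (G', D)" by (cases F)
    have "set_mset D \<subseteq> {1..m}" "chi_independent l m (set_mset D)" using inv F GD by auto
    then show "no_broken_circuit_in_support l m F"
      using support_subset[of D G'] unfolding GD no_broken_circuit_in_support_def chi_independent_def
      by blast
  qed
qed

end

end

theorem proposition5p2:
  fixes b :: "nat \<Rightarrow> real ^ ('d::{finite,linorder})"
    and l :: "nat \<Rightarrow> 'd cpoly"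
    and m :: nat
  assumes "\<And>j. j \<in> {1..m} \<Longrightarrow> b j \<noteq> 0"
    and "\<And>j. j \<in> {1..m} \<Longrightarrow> l j = linear_function (b j)"
    and "inj_on l {1..m}"
  shows
    "(\<forall>s. ratfun.independent {1 / (\<Prod>i\<in>I. Fract (l i) 1) | I. chi_independent l m I \<and> card I = s}) \<and>
     (\<forall>M A. set_mset A \<subseteq> {1..m} \<and> size A = M \<longrightarrow>
        1 / (\<Prod>j\<in>#A. Fract (l j) 1) \<in>
          ratfun.span {1 / (\<Prod>i\<in>I. Fract (l i) 1 ^ p i) | I p.
            chi_independent l m I \<and> (\<forall>i\<in>I. p i \<ge> 1) \<and> (\<Sum>i\<in>I. p i) = M}) \<and>
     (\<forall>G p. (\<forall>j\<in>{1..m}. p j \<ge> 1) \<longrightarrow>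
        simple_decomp_terminates l m G p \<and>
        (\<forall>S. simple_decomp_output l m G p S \<longrightarrow>
           (\<Sum>F\<in>#S. frac_val l F) = Fract G (\<Prod>j\<in>{1..m}. l j ^ p j) \<and>
           (\<forall>F\<in>#S. no_broken_circuit_in_support l m F)))"
proof -
  interpret linear_functions b l m
    using assms by unfold_locales
  show ?thesis
    using independent_reciprocals reciprocal_in_span simple_decomp_terminates
      simple_decomp_output_correct by blast
qed

end
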